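(* \textsc{Dilation $t$-Augmentation} can be solved in time $2^{\mathcal{O}(k\log k)}\cdot \Delta^{\mathcal{O}(kt^2)}\cdot n^{\mathcal{O}(1)}$, where $\Delta$ denotes the maximum degree of the graph $G$ and $n$ the number of vertices ($\Gamma$ is arbitrary).
   Context: Let $\Gamma$ be a finite undirected unweighted graph with vertex set $V$, and let $d_\Gamma(u,v)$ denote the shortest-path (hop) distance in $\Gamma$. A graph $G$ on the same vertex set $V$ is viewed as edge-weighted: each edge $(u,v)$ of $G$ has weight $d_\Gamma(u,v)$, and $d_G(u,v)$ denotes the weighted shortest-path distance in $G$. For a set $S$ of non-edges of $G$, $G+S=(V,E(G)\cup S)$ with the same weighting rule. $G+S$ has dilation at most $t$ if $d_{G+S}(u,v)\le t\cdot d_\Gamma(u,v)$ for all $u,v\in V$. \textsc{Dilation $t$-Augmentation}: given $(G,\Gamma,k)$, decide whether there is a set $S$ of at most $k$ non-edges of $G$ such that $G+S$ has dilation at most $t$. *)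

theory Defs
  imports Complex_Main "HOL-Library.Extended_Real"
begin

section \<open>Dilation in graphs\<close>

text \<open>
  Vertices are the numbers below \<open>n\<close>; a simple graph is its set of edges, each edge being a
  two-element set.
\<close>

definition all_pairs :: "nat \<Rightarrow> nat set set" where
  "all_pairs n = {{u, v} | u v. u < n \<and> v < n \<and> u \<noteq> v}"

definition simple_graph :: "nat \<Rightarrow> nat set set \<Rightarrow> bool" where
  "simple_graph n E \<longleftrightarrow> E \<subseteq> all_pairs n"

definition non_edges :: "nat \<Rightarrow> nat set set \<Rightarrow> nat set set" where
  "non_edges n E = all_pairs n - E"

definition degree :: "nat set set \<Rightarrow> nat \<Rightarrow> nat" where
  "degree E v = card {e \<in> E. v \<in> e}"

definition max_degree :: "nat \<Rightarrow> nat set set \<Rightarrow> nat" where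
  "max_degree n E = Max (degree E ` {..<n})"

definition walk :: "nat set set \<Rightarrow> nat \<Rightarrow> nat list \<Rightarrow> nat \<Rightarrow> bool" where
  "walk E u xs v \<longleftrightarrow> xs \<noteq> [] \<and> hd xs = u \<and> last xs = v \<and> successively (\<lambda>x y. {x, y} \<in> E) xs"

fun walk_weight :: "(nat \<Rightarrow> nat \<Rightarrow> enat) \<Rightarrow> nat list \<Rightarrow> enat" where
  "walk_weight w (x # y # xs) = w x y + walk_weight w (y # xs)"
| "walk_weight w _ = 0"

text \<open>
  Distances are extended naturals: the infimum over the empty set of walks is \<open>\<infinity>\<close>, so neither
  graph needs to be connected, and an edge of \<open>G\<close> joining different components of \<open>\<Gamma>\<close> has
  weight \<open>\<infinity>\<close>.
\<close>

definition weighted_dist :: "(nat \<Rightarrow> nat \<Rightarrow> enat) \<Rightarrow> nat set set \<Rightarrow> nat \<Rightarrow> nat \<Rightarrow> enat" where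
  "weighted_dist w E u v = (INF xs \<in> {xs. walk E u xs v}. walk_weight w xs)"

definition hop_dist :: "nat set set \<Rightarrow> nat \<Rightarrow> nat \<Rightarrow> enat" where
  "hop_dist \<Gamma> = weighted_dist (\<lambda>_ _. 1) \<Gamma>"

definition dilation_at_most :: "nat \<Rightarrow> nat set set \<Rightarrow> nat set set \<Rightarrow> real \<Rightarrow> bool" where
  "dilation_at_most n \<Gamma> E t \<longleftrightarrow>
     (\<forall>u<n. \<forall>v<n. ereal_of_enat (weighted_dist (hop_dist \<Gamma>) E u v)
                      \<le> ereal t * ereal_of_enat (hop_dist \<Gamma> u v))"

text \<open>An instance is \<open>(n, G, \<Gamma>, k)\<close>.\<close>

type_synonym aug_instance = "nat \<times> nat set set \<times> nat set set \<times> nat"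

definition valid_instance :: "aug_instance \<Rightarrow> bool" where
  "valid_instance = (\<lambda>(n, G, \<Gamma>, k). 0 < n \<and> simple_graph n G \<and> simple_graph n \<Gamma>)"

definition dilation_augmentable :: "real \<Rightarrow> aug_instance \<Rightarrow> bool" where
  "dilation_augmentable t = (\<lambda>(n, G, \<Gamma>, k).
     \<exists>S \<subseteq> non_edges n G. card S \<le> k \<and> dilation_at_most n \<Gamma> (G \<union> S) t)"


section \<open>Model of computation\<close>

text \<open>
  Programs are first-order recursive functional programs over binary trees (pure LISP), evaluated
  by value; the running time is the number of evaluation steps. Every step performs a constant
  amount of work on pointers: there is no arithmetic, and the only test is whether a tree is a
  leaf. A run of \<open>T\<close> steps allocates at most \<open>T\<close> new nodes, and so it can be simulated by a Turing
  machine or a logarithmic-cost RAM in time polynomial in \<open>T\<close> and the size of the input, and vice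
  versa. (See N. D. Jones, Computability and Complexity from a Programming Perspective, MIT Press
  1997.) A time bound of the form \<open>2^O(k log k) * D^O(k t^2) * n^O(1)\<close> is not affected by such
  polynomial overheads.
\<close>

datatype tree = Leaf | Node tree tree

datatype exp =
    Arg nat                (* de Bruijn index into the environment *)
  | Quote tree
  | Mk_Node exp exp
  | First exp
  | Second exp
  | Ite exp exp exp        (* anything but a leaf counts as true *)
  | Bind exp exp           (* the value of the first expression becomes Arg 0 in the second *)
  | Call nat "exp list"

type_synonym program = "exp list"  (* entry f is the body of function f; function 0 is run *)

fun first :: "tree \<Rightarrow> tree" where
  "first Leaf = Leaf"
| "first (Node a b) = a"

fun second :: "tree \<Rightarrow> tree" where
  "second Leaf = Leaf"
| "second (Node a b) = b"

text \<open>
  \<open>eval P env e v T\<close>: in the environment \<open>env\<close> the expression \<open>e\<close> has value \<open>v\<close>, found in \<open>T\<close> steps.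
\<close>

inductive eval :: "program \<Rightarrow> tree list \<Rightarrow> exp \<Rightarrow> tree \<Rightarrow> nat \<Rightarrow> bool"
  and evals :: "program \<Rightarrow> tree list \<Rightarrow> exp list \<Rightarrow> tree list \<Rightarrow> nat \<Rightarrow> bool"
  for P :: program where
  Arg: "i < length env \<Longrightarrow> eval P env (Arg i) (env ! i) 1"
| Quote: "eval P env (Quote v) v 1"
| Mk_Node: "eval P env a v T \<Longrightarrow> eval P env b w U \<Longrightarrow> eval P env (Mk_Node a b) (Node v w) (T + U + 1)"
| First: "eval P env a v T \<Longrightarrow> eval P env (First a) (first v) (T + 1)"
| Second: "eval P env a v T \<Longrightarrow> eval P env (Second a) (second v) (T + 1)"
| IteTrue: "eval P env a v T \<Longrightarrow> v \<noteq> Leaf \<Longrightarrow> eval P env b w U \<Longrightarrow>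
    eval P env (Ite a b c) w (T + U + 1)"
| IteFalse: "eval P env a Leaf T \<Longrightarrow> eval P env c w U \<Longrightarrow>
    eval P env (Ite a b c) w (T + U + 1)"
| Bind: "eval P env a v T \<Longrightarrow> eval P (v # env) b w U \<Longrightarrow> eval P env (Bind a b) w (T + U + 1)"
| Call: "evals P env es vs T \<Longrightarrow> f < length P \<Longrightarrow> eval P vs (P ! f) w U \<Longrightarrow>
    eval P env (Call f es) w (T + U + 1)"
| Nil: "evals P env [] [] 0"
| Cons: "eval P env e v T \<Longrightarrow> evals P env es vs U \<Longrightarrow> evals P env (e # es) (v # vs) (T + U)"

inductive_cases eval_elims:
  "eval P env (Arg i) v T" "eval P env (Quote x) v T" "eval P env (Mk_Node a b) v T"
  "eval P env (First a) v T" "eval P env (Second a) v T" "eval P env (Ite a b c) v T"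
  "eval P env (Bind a b) v T" "eval P env (Call f es) v T"
inductive_cases evals_elims:
  "evals P env [] vs T" "evals P env (e # es) vs T"

lemma
  shows eval_deterministic:
      "eval P env e v T \<Longrightarrow> eval P env e v' T' \<Longrightarrow> v' = v \<and> T' = T"
    and evals_deterministic:
      "evals P env es vs T \<Longrightarrow> evals P env es vs' T' \<Longrightarrow> vs' = vs \<and> T' = T"
proof (induction arbitrary: v' T' and vs' T' rule: eval_evals.inducts)
  case (Arg i env)
  then show ?case by (elim eval_elims) simp
next
  case (Quote env v)
  then show ?case by (elim eval_elims) simp
next
  case (Mk_Node env a v T b w U)
  from Mk_Node.prems show ?case by cases (auto dest!: Mk_Node.IH(2,4))
next
  case (First env a v T)
  from First.prems show ?case by cases (auto dest!: First.IH(2))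
next
  case (Second env a v T)
  from Second.prems show ?case by cases (auto dest!: Second.IH(2))
next
  case (IteTrue env a v T b w U c)
  from IteTrue.prems show ?case by cases (use IteTrue.hyps in \<open>auto dest!: IteTrue.IH(2,4)\<close>)
next
  case (IteFalse env a T c w U b)
  from IteFalse.prems show ?case by cases (auto dest!: IteFalse.IH(2,4))
next
  case (Bind env a v T b w U)
  from Bind.prems show ?case by cases (auto dest!: Bind.IH(2,4))
next
  case (Call env es vs T f w U)
  from Call.prems show ?case by cases (auto dest!: Call(2,5))
next
  case (Nil env)
  then show ?case by (elim evals_elims) simp
next
  case (Cons env e v T es vs U)
  from Cons.prems show ?case by cases (auto dest!: Cons.IH(2,4))
qed

definition runs :: "program \<Rightarrow> tree list \<Rightarrow> tree \<Rightarrow> nat \<Rightarrow> bool" where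
  "runs P input out T \<longleftrightarrow> P \<noteq> [] \<and> eval P input (P ! 0) out T"

text \<open>
  The program halts on every valid instance within the time bound and accepts, by returning a tree
  other than a leaf, exactly the yes-instances.
\<close>

definition decides_within ::
  "program \<Rightarrow> ('i \<Rightarrow> tree list) \<Rightarrow> ('i \<Rightarrow> bool) \<Rightarrow> ('i \<Rightarrow> bool) \<Rightarrow> ('i \<Rightarrow> real) \<Rightarrow> bool"
where
  "decides_within P enc valid yes bound \<longleftrightarrow>
     (\<forall>x. valid x \<longrightarrow>
       (\<exists>out T. runs P (enc x) out T \<and> (out \<noteq> Leaf \<longleftrightarrow> yes x) \<and> real T \<le> bound x))"


section \<open>Encoding of instances\<close>

text \<open>
  The graphs are given by their adjacency matrices, as lists of rows. The number \<open>k\<close> is in unary;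
  as \<open>k\<close> is at most \<open>2^(k log k)\<close>, conversion from binary would be within the time bound.
\<close>

fun tree_of_list :: "tree list \<Rightarrow> tree" where
  "tree_of_list [] = Leaf"
| "tree_of_list (x # xs) = Node x (tree_of_list xs)"

definition tree_of_bool :: "bool \<Rightarrow> tree" where
  "tree_of_bool b = (if b then Node Leaf Leaf else Leaf)"

definition tree_of_nat :: "nat \<Rightarrow> tree" where
  "tree_of_nat k = tree_of_list (replicate k Leaf)"

definition tree_of_graph :: "nat \<Rightarrow> nat set set \<Rightarrow> tree" where
  "tree_of_graph n E =
     tree_of_list (map (\<lambda>u. tree_of_list (map (\<lambda>v. tree_of_bool ({u, v} \<in> E)) [0..<n])) [0..<n])"

definition encode_instance :: "aug_instance \<Rightarrow> tree list" where
  "encode_instance = (\<lambda>(n, G, \<Gamma>, k). [tree_of_graph n G, tree_of_graph n \<Gamma>, tree_of_nat k])"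

end

theory Submission
  imports Defs
begin

text \<open>
  The dilation is attained at an edge of \<open>\<Gamma>\<close>, so \<open>t\<close> may be replaced by \<open>T = \<lfloor>t\<rfloor>\<close>. Call a vertex in
  conflict if it is an end of an edge of \<open>\<Gamma>\<close> whose ends have distance more than \<open>T\<close> in \<open>G\<close>. If \<open>S\<close> is
  a solution, each vertex in conflict is within \<open>T\<close> steps (in \<open>G\<close>) of one of the at most \<open>2k\<close> ends of
  \<open>S\<close>; so a greedy choice of vertices in conflict with pairwise distance more than \<open>2T\<close> stops after
  at most \<open>2k\<close> of them, the centers. On the other hand, the walks of weight at most \<open>T\<close> that repair
  the conflicts stay within \<open>T\<^sup>2\<close> steps of the vertices in conflict. Hence \<open>S\<close> may be chosen among the
  pairs of vertices within \<open>T\<^sup>2 + 2T\<close> steps of a center. There are only \<open>k \<Delta>\<^bsup>O(t\<^sup>2)\<^esup>\<close> such vertices,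
  and the program tries all sequences of at most \<open>2k\<close> of them. All distances are computed by the
  Bellman-Ford algorithm on unary numbers.
\<close>

section \<open>Walks and distances\<close>

text \<open>The degrees of \<Gamma> are unbounded, so a set of few vertices must be a ball with
  respect to steps in \<open>G\<close>. A repairing walk gives no such ball directly, as its added
  edges are not steps in \<open>G\<close>. But its weights are distances in \<Gamma>, so each of its
  vertices is reached by at most \<open>T\<close> edges of \<Gamma>, and every such edge that is not
  in conflict costs at most \<open>T\<close> steps in \<open>G\<close>; hence the square. A ball of
  radius r has at most 2 * D^(r + 1) vertices, where D = max 1 \<Delta>. With at most 2k centers
  this leaves at most 4 * k * D^e candidates, where e = T^2 + 2T + 1. Choosing up to 2k of them
  contributes k^(2k) * D^(2ke); the first factor is the source of k log k. All constants must be
  independent of t, so the cost of a distance or of a test may not depend on \<open>T\<close>. Two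
  degenerate cases shape the estimates: for k = 1 the exponent k log k vanishes, and for maximum
  degree at most 1 the powers of D do not grow with the radius.\<close>

lemma walk_single [simp]: "walk E u [x] v \<longleftrightarrow> x = u \<and> x = v"
  by (auto simp: walk_def)

lemma walk_Cons2 [simp]: "walk E u (x # y # xs) v \<longleftrightarrow> x = u \<and> {x, y} \<in> E \<and> walk E y (y # xs) v"
  by (auto simp: walk_def)

lemma walk_hd: "walk E u (x # xs) v \<Longrightarrow> x = u"
  by (auto simp: walk_def)

lemma not_walk_Nil [simp]: "\<not> walk E u [] v"
  by (auto simp: walk_def)

lemma walk_append:
  "walk E u (xs @ [x]) x \<Longrightarrow> walk E x (x # ys) v \<Longrightarrow> walk E u (xs @ x # ys) v"
  by (induction xs arbitrary: u rule: induct_list012) auto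

lemma walk_weight_append:
  "walk_weight w (xs @ x # ys) = walk_weight w (xs @ [x]) + walk_weight w (x # ys)"
  by (induction xs rule: induct_list012) (auto simp: add.assoc)

lemma walk_snocE:
  assumes "walk E u xs v"
  obtains ys where "xs = ys @ [v]"
  using assms unfolding walk_def by (metis append_butlast_last_id)

lemma wd_le: "walk E u xs v \<Longrightarrow> weighted_dist w E u v \<le> walk_weight w xs"
  unfolding weighted_dist_def by (rule INF_lower) simp

text \<open>Extended naturals are well-ordered, so an infimum over a nonempty set is a minimum.
  Without any walk the infimum is \<infinity>.\<close>

lemma wd_attained:
  assumes "weighted_dist w E u v \<noteq> \<infinity>"
  obtains xs where "walk E u xs v" "walk_weight w xs = weighted_dist w E u v"
proof -
  let ?A = "walk_weight w ` {xs. walk E u xs v}"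
  have "?A \<noteq> {}"
    using assms unfolding weighted_dist_def by (metis Inf_empty top_enat_def)
  then have "Inf ?A \<in> ?A"
    unfolding Inf_enat_def by (auto intro: LeastI)
  then show thesis
    using that unfolding weighted_dist_def by auto
qed

lemma wd_le_iff:
  "weighted_dist w E u v \<le> enat m \<longleftrightarrow> (\<exists>xs. walk E u xs v \<and> walk_weight w xs \<le> enat m)"
proof
  assume *: "weighted_dist w E u v \<le> enat m"
  then have "weighted_dist w E u v \<noteq> \<infinity>" by (cases "weighted_dist w E u v") auto
  then show "\<exists>xs. walk E u xs v \<and> walk_weight w xs \<le> enat m"
    by (rule wd_attained) (use * in auto)
next
  assume "\<exists>xs. walk E u xs v \<and> walk_weight w xs \<le> enat m"
  then obtain xs where "walk E u xs v" "walk_weight w xs \<le> enat m" by blast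
  then show "weighted_dist w E u v \<le> enat m"
    using order_trans[OF wd_le] by simp
qed

lemma wd_refl [simp]: "weighted_dist w E u u = 0"
  using wd_le[of E u "[u]" u w] by auto

lemma wd_triangle: "weighted_dist w E u v \<le> weighted_dist w E u x + weighted_dist w E x v"
proof (cases "weighted_dist w E u x = \<infinity> \<or> weighted_dist w E x v = \<infinity>")
  case False
  then have fin: "weighted_dist w E u x \<noteq> \<infinity> \<and> weighted_dist w E x v \<noteq> \<infinity>" by simp
  obtain xs where xs: "walk E u xs x" "walk_weight w xs = weighted_dist w E u x"
    by (rule wd_attained[OF fin[THEN conjunct1]])
  obtain ys where ys: "walk E x ys v" "walk_weight w ys = weighted_dist w E x v"
    by (rule wd_attained[OF fin[THEN conjunct2]])
  from xs(1) obtain xs' where xs': "xs = xs' @ [x]" by (rule walk_snocE)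
  from ys(1) obtain ys' where ys': "ys = x # ys'" by (cases ys) (auto dest: walk_hd)
  show ?thesis
    using wd_le[OF walk_append[OF xs(1)[unfolded xs'] ys(1)[unfolded ys']], of w]
walk_weight_append[of w xs' x ys'] xs(2) ys(2)
    by (simp only: xs' ys')
qed (elim disjE; simp)

lemma wd_edge: "{u, v} \<in> E \<Longrightarrow> weighted_dist w E u v \<le> w u v"
  using wd_le[of E u "[u, v]" v w] by simp

lemma walk_mono: "walk E u xs v \<Longrightarrow> E \<subseteq> F \<Longrightarrow> walk F u xs v"
  by (induction xs arbitrary: u rule: induct_list012) auto

lemma wd_mono: "E \<subseteq> F \<Longrightarrow> weighted_dist w F u v \<le> weighted_dist w E u v"
  unfolding weighted_dist_def by (rule INF_superset_mono) (auto intro: walk_mono)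

lemma walk_rev:
  assumes "walk E u xs v" shows "walk E v (rev xs) u"
  using assms unfolding walk_def successively_rev
  by (auto simp: hd_rev last_rev insert_commute)

lemma walk_weight_rev:
  assumes "\<And>x y. w x y = w y x"
  shows "walk_weight w (rev xs) = walk_weight w xs"
proof (induction xs rule: induct_list012)
  case (3 x y zs)
  have "walk_weight w (rev (x # y # zs)) = walk_weight w (rev zs @ y # [x])" by simp
  also have "\<dots> = walk_weight w (rev (y # zs)) + w y x"
    by (subst walk_weight_append) simp
  finally show ?case using 3 assms[of x y] by (simp add: add.commute)
qed auto

lemma wd_commute:
  assumes "\<And>x y. w x y = w y x"
  shows "weighted_dist w E u v = weighted_dist w E v u"
proof -
  have "weighted_dist w E u v \<le> weighted_dist w E v u" for u v
    unfolding weighted_dist_def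
  proof (rule INF_mono)
    fix xs assume "xs \<in> {xs. walk E v xs u}"
    then show "\<exists>ys\<in>{xs. walk E u xs v}. walk_weight w ys \<le> walk_weight w xs"
      using walk_weight_rev[of w, OF assms] walk_rev by (intro bexI[of _ "rev xs"]) auto
  qed
  then show ?thesis by (simp add: antisym)
qed

lemma hop_dist_commute: "hop_dist E u v = hop_dist E v u"
  unfolding hop_dist_def by (rule wd_commute) simp

lemma walk_vertices:
  assumes "walk E u xs v" "u < n" "E \<subseteq> Pow {..<n}"
  shows "set xs \<subseteq> {..<n}"
  using assms(1,2)
proof (induction xs arbitrary: u rule: induct_list012)
  case (3 x y zs)
  then have "y < n" using assms(3) by auto
  with 3 show ?case by auto
qed auto

text \<open>Cycles are cut out from the end of the walk towards its head: if the head occurs again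
  in the shortened tail, the walk starts at that occurrence instead. Weights are never negative, so
  the total does not grow.\<close>

lemma walk_shorten:
  "walk E u xs v \<Longrightarrow> \<exists>ys. walk E u ys v \<and> distinct ys \<and> walk_weight w ys \<le> walk_weight w xs"
proof (induction xs arbitrary: u rule: induct_list012)
  case (2 x)
  then show ?case by (intro exI[of _ "[x]"]) auto
next
  case (3 x y zs)
  then have E: "{x, y} \<in> E" "x = u" by auto
  from 3 obtain ys where ys: "walk E y ys v" "distinct ys" "walk_weight w ys \<le> walk_weight w (y # zs)"
    by auto
  show ?case
  proof (cases "x \<in> set ys")
    case True
    then obtain as bs where ab: "ys = as @ x # bs" by (meson split_list)
    have "walk E x (x # bs) v"
      using ys(1) unfolding ab by (auto simp: walk_def successively_append_iff)
    moreover have "walk_weight w (x # bs) \<le> walk_weight w ys"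
      unfolding ab using walk_weight_append[of w as x bs] by simp
    moreover have "walk_weight w (y # zs) \<le> walk_weight w (x # y # zs)" by (simp add: add_increasing)
    ultimately show ?thesis
      using ys E unfolding ab
      by (intro exI[of _ "x # bs"]) (metis distinct_append order_trans)
  next
    case False
    obtain ys' where "ys = y # ys'" using ys(1) by (cases ys) (auto dest: walk_hd)
    then show ?thesis
      using ys E False by (intro exI[of _ "x # ys"]) (auto intro: add_left_mono)
  qed
qed auto

text \<open>Distances to, rather than from, the vertex \<open>v\<close>, so that walks are extended at their head.\<close>

primrec bellman_ford :: "(nat \<Rightarrow> nat \<Rightarrow> enat) \<Rightarrow> nat \<Rightarrow> nat \<Rightarrow> nat \<Rightarrow> nat \<Rightarrow> enat" where
  "bellman_ford w n v 0 = (\<lambda>x. if x = v then 0 else \<infinity>)"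
| "bellman_ford w n v (Suc i) = (\<lambda>x. INF y \<in> {..<n}. w x y + bellman_ford w n v i y)"

text \<open>The zero on the diagonal lets a walk stand still, so that round \<open>i\<close> covers
  all walks with at most \<open>i\<close> edges. It also overrides loops in
  \<open>E\<close>.\<close>

definition pair_weight :: "(nat \<Rightarrow> nat \<Rightarrow> enat) \<Rightarrow> nat set set \<Rightarrow> nat \<Rightarrow> nat \<Rightarrow> enat" where
  "pair_weight w E x y = (if x = y then 0 else if {x, y} \<in> E then w x y else \<infinity>)"

lemma bellman_ford_le:
  assumes "walk E x xs v" "set xs \<subseteq> {..<n}" "length xs \<le> Suc i"
  shows "bellman_ford (pair_weight w E) n v i x \<le> walk_weight w xs"
  using assms
proof (induction i arbitrary: x xs)
  case 0
  then show ?case by (cases xs) auto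
next
  case (Suc i)
  \<comment> \<open>\<open>remdups_adj.cases\<close> serves only as a split into empty, singleton
    and longer lists.\<close>
  consider "xs = [x]" "x = v" | y ys where "xs = x # y # ys"
    using Suc.prems(1) by (cases xs rule: remdups_adj.cases) auto
  then show ?case
  proof cases
    case 1
    then have "bellman_ford (pair_weight w E) n v i x \<le> 0" using Suc.IH[of x "[x]"] Suc.prems by auto
    then have "pair_weight w E x x + bellman_ford (pair_weight w E) n v i x \<le> walk_weight w xs"
      by (simp add: pair_weight_def)
    then show ?thesis using 1 Suc.prems unfolding bellman_ford.simps by (intro INF_lower2[of x]) auto
  next
    case 2
    then have "bellman_ford (pair_weight w E) n v i y \<le> walk_weight w (y # ys)"
      using Suc.IH[of y "y # ys"] Suc.prems by auto
    moreover have "pair_weight w E x y \<le> w x y" using 2 Suc.prems by (auto simp: pair_weight_def)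
    ultimately have "pair_weight w E x y + bellman_ford (pair_weight w E) n v i y \<le> walk_weight w xs"
      using 2 by (simp add: add_mono)
    then show ?thesis using 2 Suc.prems by (auto intro!: INF_lower2[of y])
  qed
qed

lemma wd_le_bellman_ford: "weighted_dist w E x v \<le> bellman_ford (pair_weight w E) n v i x"
proof (induction i arbitrary: x)
  case (Suc i)
  have "weighted_dist w E x v \<le> pair_weight w E x y + bellman_ford (pair_weight w E) n v i y" for y
  proof -
    have "weighted_dist w E x y \<le> pair_weight w E x y"
      by (auto simp: pair_weight_def wd_edge)
    then show ?thesis
      using wd_triangle[of w E x v y] Suc.IH[of y] by (meson add_mono order_trans)
  qed
  then show ?case by (auto intro: INF_greatest)
qed auto

text \<open>A walk without repetitions has at most \<open>n\<close> vertices, hence fewer than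
  \<open>n\<close> edges. One round more than necessary is made because the program counts rounds on
  its list of vertices.\<close>

lemma bellman_ford_eq_wd:
  assumes "x < n" "E \<subseteq> Pow {..<n}"
  shows "bellman_ford (pair_weight w E) n v n x = weighted_dist w E x v"
proof (rule antisym)
  show "bellman_ford (pair_weight w E) n v n x \<le> weighted_dist w E x v"
    unfolding weighted_dist_def
  proof (rule INF_greatest)
    fix xs assume "xs \<in> {xs. walk E x xs v}"
    then obtain ys where ys: "walk E x ys v" "distinct ys" "walk_weight w ys \<le> walk_weight w xs"
      using walk_shorten by blast
    have s: "set ys \<subseteq> {..<n}" using walk_vertices[OF ys(1) assms] .
    then have "length ys \<le> n" using ys(2) by (metis card_lessThan card_mono distinct_card finite_lessThan)
    then show "bellman_ford (pair_weight w E) n v n x \<le> walk_weight w xs"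
      using bellman_ford_le[OF ys(1) s, of n w] ys(3) by auto
  qed
qed (rule wd_le_bellman_ford)

text \<open>The search may list a pair of equal vertices, which is a singleton and not a non-edge.
  Dropping it is harmless, as \<open>pair_weight\<close> never looks at loops.\<close>

lemma wd_no_loops:
  assumes "x < n" "E \<subseteq> Pow {..<n}" "F \<subseteq> Pow {..<n}" "\<And>x y. x \<noteq> y \<Longrightarrow> {x, y} \<in> E \<longleftrightarrow> {x, y} \<in> F"
  shows "weighted_dist w E x v = weighted_dist w F x v"
proof -
  have "pair_weight w E = pair_weight w F" using assms(4) by (auto simp: pair_weight_def fun_eq_iff)
  then show ?thesis using bellman_ford_eq_wd assms(1-3) by metis
qed

text \<open>Numbers are unary, so the time of arithmetic is governed by the finite values that
  occur; \<infinity> is represented by a leaf and costs nothing.\<close>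

definition at_most_or_inf :: "nat \<Rightarrow> enat \<Rightarrow> bool" where
  "at_most_or_inf b x \<longleftrightarrow> x = \<infinity> \<or> x \<le> enat b"

lemma at_most_or_inf_add:
  "at_most_or_inf a x \<Longrightarrow> at_most_or_inf b y \<Longrightarrow> at_most_or_inf (a + b) (x + y)"
  by (cases x; cases y) (auto simp: at_most_or_inf_def)

lemma at_most_or_inf_INF:
  assumes "\<And>x. x \<in> A \<Longrightarrow> at_most_or_inf b (f x)"
  shows "at_most_or_inf b (INF x\<in>A. f x)"
proof (cases "\<forall>x\<in>A. f x = \<infinity>")
  case True
  then have "(INF x\<in>A. f x) = \<infinity>" by (auto simp: top_enat_def[symmetric] intro!: INF_eqI)
  then show ?thesis by (simp add: at_most_or_inf_def)
next
  case False
  then obtain x where "x \<in> A" "f x \<le> enat b" using assms unfolding at_most_or_inf_def by blast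
  then show ?thesis by (auto simp: at_most_or_inf_def intro: INF_lower2)
qed

lemma at_most_or_inf_bellman_ford:
  assumes "\<And>x y. x < n \<Longrightarrow> y < n \<Longrightarrow> at_most_or_inf b (w x y)" "x < n"
  shows "at_most_or_inf (i * b) (bellman_ford w n v i x)"
  using assms(2)
proof (induction i arbitrary: x)
  case (Suc i)
  then show ?case
    by (auto simp: intro!: at_most_or_inf_INF at_most_or_inf_add assms(1))
qed (auto simp: at_most_or_inf_def)

section \<open>Vertices in conflict\<close>

lemma hop_dist_edge: "{u, v} \<in> E \<Longrightarrow> hop_dist E u v \<le> 1"
  unfolding hop_dist_def using wd_edge[of u v E "\<lambda>_ _. 1"] by simp

lemma hop_dist_triangle: "hop_dist E u v \<le> hop_dist E u x + hop_dist E x v"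
  unfolding hop_dist_def by (rule wd_triangle)

lemma hop_dist_refl [simp]: "hop_dist E u u = 0"
  unfolding hop_dist_def by (rule wd_refl)

lemma one_le_hop_dist: "x \<noteq> y \<Longrightarrow> 1 \<le> hop_dist E x y"
  unfolding hop_dist_def weighted_dist_def
proof (rule INF_greatest)
  fix xs assume "x \<noteq> y" "xs \<in> {xs. walk E x xs y}"
  then show "1 \<le> walk_weight (\<lambda>_ _. 1) xs"
    by (cases xs rule: remdups_adj.cases) auto
qed

lemma edge_neq: "simple_graph n E \<Longrightarrow> {x, y} \<in> E \<Longrightarrow> x \<noteq> y \<and> x < n \<and> y < n"
  unfolding simple_graph_def all_pairs_def by (auto simp: doubleton_eq_iff)

lemma simple_graph_Pow: "simple_graph n E \<Longrightarrow> E \<subseteq> Pow {..<n}"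
  unfolding simple_graph_def all_pairs_def by auto

text \<open>The ends of an edge are distinct, so each edge weighs at least 1. This turns bounds on
  weight into bounds on steps in \<open>G\<close>, to which the maximum degree applies.\<close>

lemma hop_dist_le_wd:
  assumes "simple_graph n E"
  shows "hop_dist E u v \<le> weighted_dist (hop_dist \<Gamma>) E u v"
proof -
  have *: "walk_weight (\<lambda>_ _. 1) xs \<le> walk_weight (hop_dist \<Gamma>) xs" if "walk E u xs v" for xs u
    using that
  proof (induction xs arbitrary: u rule: induct_list012)
    case (3 x y zs)
    then have "1 \<le> hop_dist \<Gamma> x y" using edge_neq[OF assms, of x y] by (auto intro: one_le_hop_dist)
    moreover have "walk_weight (\<lambda>_ _. 1) (y # zs) \<le> walk_weight (hop_dist \<Gamma>) (y # zs)"
      using 3 by auto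
    ultimately show ?case by (simp add: add_mono)
  qed auto
  show ?thesis
    unfolding hop_dist_def[of E] weighted_dist_def
    by (rule INF_mono) (use * in \<open>auto simp: hop_dist_def\<close>)
qed

lemma wd_le_scaled_walk:
  assumes "\<And>x y. {x, y} \<in> \<Gamma> \<Longrightarrow> weighted_dist w E x y \<le> enat T" "walk \<Gamma> u xs v"
  shows "weighted_dist w E u v \<le> enat T * walk_weight (\<lambda>_ _. 1) xs"
  using assms(2)
proof (induction xs arbitrary: u rule: induct_list012)
  case (3 x y zs)
  then have "weighted_dist w E x y \<le> enat T" "weighted_dist w E y v \<le> enat T * walk_weight (\<lambda>_ _. 1) (y # zs)"
    using assms(1) by auto
  then have "weighted_dist w E x v \<le> enat T + enat T * walk_weight (\<lambda>_ _. 1) (y # zs)"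
    using wd_triangle[of w E x v y] by (meson add_mono order_trans)
  then show ?case using 3 by (simp add: distrib_left)
qed auto

text \<open>On an edge of \<Gamma> the condition compares an integer with \<open>t\<close>, so
  rounding \<open>t\<close> down loses nothing. The bounds for edges add up along a shortest walk of
  \<Gamma>. Pairs in different components of \<Gamma> are unconstrained, since a positive
  \<open>t\<close> times \<infinity> is \<infinity>.\<close>

lemma dilation_at_most_iff:
  assumes "simple_graph n \<Gamma>" "1 \<le> t"
  shows "dilation_at_most n \<Gamma> E t \<longleftrightarrow>
    (\<forall>u<n. \<forall>v<n. {u, v} \<in> \<Gamma> \<longrightarrow> weighted_dist (hop_dist \<Gamma>) E u v \<le> enat (nat \<lfloor>t\<rfloor>))"
proof
  assume L: "dilation_at_most n \<Gamma> E t"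
  show "\<forall>u<n. \<forall>v<n. {u, v} \<in> \<Gamma> \<longrightarrow> weighted_dist (hop_dist \<Gamma>) E u v \<le> enat (nat \<lfloor>t\<rfloor>)"
  proof (intro allI impI)
    fix u v assume uv: "u < n" "v < n" "{u, v} \<in> \<Gamma>"
    then have "hop_dist \<Gamma> u v = 1"
      using hop_dist_edge one_le_hop_dist edge_neq[OF assms(1)] by (metis antisym)
    moreover have "ereal_of_enat 1 = ereal 1" by (simp add: one_enat_def)
    ultimately have "ereal_of_enat (weighted_dist (hop_dist \<Gamma>) E u v) \<le> ereal t"
      using L uv unfolding dilation_at_most_def by fastforce
    then show "weighted_dist (hop_dist \<Gamma>) E u v \<le> enat (nat \<lfloor>t\<rfloor>)"
      by (cases "weighted_dist (hop_dist \<Gamma>) E u v") (auto simp: le_nat_floor)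
  qed
next
  assume R: "\<forall>u<n. \<forall>v<n. {u, v} \<in> \<Gamma> \<longrightarrow> weighted_dist (hop_dist \<Gamma>) E u v \<le> enat (nat \<lfloor>t\<rfloor>)"
  then have R': "weighted_dist (hop_dist \<Gamma>) E x y \<le> enat (nat \<lfloor>t\<rfloor>)" if "{x, y} \<in> \<Gamma>" for x y
    using that edge_neq[OF assms(1)] by blast
  show "dilation_at_most n \<Gamma> E t"
    unfolding dilation_at_most_def
  proof (intro allI impI)
    fix u v
    show "ereal_of_enat (weighted_dist (hop_dist \<Gamma>) E u v) \<le> ereal t * ereal_of_enat (hop_dist \<Gamma> u v)"
    proof (cases "hop_dist \<Gamma> u v")
      case (enat h)
      then obtain xs where xs: "walk \<Gamma> u xs v" "walk_weight (\<lambda>_ _. 1) xs = enat h"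
        unfolding hop_dist_def using wd_attained by (metis enat.distinct(2))
      from wd_le_scaled_walk[OF R' xs(1)]
      have le: "weighted_dist (hop_dist \<Gamma>) E u v \<le> enat (nat \<lfloor>t\<rfloor> * h)" using xs(2) by simp
      then obtain d where d: "weighted_dist (hop_dist \<Gamma>) E u v = enat d" "d \<le> nat \<lfloor>t\<rfloor> * h"
        by (cases "weighted_dist (hop_dist \<Gamma>) E u v") auto
      have "real d \<le> real (nat \<lfloor>t\<rfloor> * h)" using d(2) by (simp only: of_nat_le_iff)
      also have "\<dots> \<le> t * real h" using assms(2) by (simp add: mult_right_mono)
      finally show ?thesis using d(1) enat by simp
    qed (use assms(2) in auto)
  qed
qed

text \<open>
  A walk of weight at most \<open>T\<close> from \<open>u\<close> stays within \<open>\<Gamma>\<close>-distance \<open>T\<close> of \<open>u\<close>. On a \<open>\<Gamma>\<close>-walk every edge that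
  is not in conflict can be replaced by at most \<open>T\<close> edges of \<open>G\<close>. So if \<open>u\<close> is in conflict, then every
  vertex of the walk is within \<open>T\<^sup>2\<close> steps in \<open>G\<close> of the last vertex in conflict on such a \<open>\<Gamma>\<close>-walk.
\<close>

definition conflict :: "nat \<Rightarrow> nat set set \<Rightarrow> nat set set \<Rightarrow> nat \<Rightarrow> nat \<Rightarrow> bool" where
  "conflict T \<Gamma> E u v \<longleftrightarrow> {u, v} \<in> \<Gamma> \<and> \<not> weighted_dist (hop_dist \<Gamma>) E u v \<le> enat T"

lemma conflict_commute: "conflict T \<Gamma> E u v \<longleftrightarrow> conflict T \<Gamma> E v u"
  unfolding conflict_def
  using wd_commute[of "hop_dist \<Gamma>" E u v] hop_dist_commute by (metis insert_commute)

text \<open>Induction along the walk with an accumulator: \<open>y\<close> is the last vertex in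
  conflict met so far, and \<open>a\<close> bounds the steps from it to the current vertex. An edge
  in conflict resets \<open>a\<close> to 0, any other edge adds \<open>T\<close>.\<close>

lemma near_conflict:
  assumes "simple_graph n E"
    and "walk \<Gamma> u xs x" "conflict T \<Gamma> E y z" "hop_dist E y u \<le> a"
  shows "\<exists>y z. conflict T \<Gamma> E y z \<and> hop_dist E y x \<le> a + enat T * walk_weight (\<lambda>_ _. 1) xs"
  using assms(2-)
proof (induction xs arbitrary: u y z a rule: induct_list012)
  case (2 x)
  then show ?case by auto
next
  case (3 v v' xs)
  then have walk: "walk \<Gamma> v' (v' # xs) x" and "{v, v'} \<in> \<Gamma>" "u = v" by auto
  let ?l = "walk_weight (\<lambda>_ _. 1) (v' # xs)"
  show ?case
  proof (cases "conflict T \<Gamma> E v v'")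
    case True
    then have "\<exists>y z. conflict T \<Gamma> E y z \<and> hop_dist E y x \<le> 0 + enat T * ?l"
      by (intro "3.IH"(2)[OF walk, of v' v]) (auto simp: conflict_commute)
    moreover have "0 + enat T * ?l \<le> a + enat T * walk_weight (\<lambda>_ _. 1) (v # v' # xs)"
      by (simp add: distrib_left add_increasing)
    ultimately show ?thesis by (meson order_trans)
  next
    case False
    then have "weighted_dist (hop_dist \<Gamma>) E v v' \<le> enat T"
      using \<open>{v, v'} \<in> \<Gamma>\<close> by (auto simp: conflict_def)
    then have "hop_dist E v v' \<le> enat T" using hop_dist_le_wd[OF assms(1)] order_trans by metis
    then have "hop_dist E y v' \<le> a + enat T"
      using hop_dist_triangle[of E y v' v] "3.prems"(3) \<open>u = v\<close> by (meson add_mono order_trans)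
    from "3.IH"(2)[OF walk "3.prems"(2) this]
    show ?thesis by (simp add: distrib_left add.assoc)
  qed
qed auto

text \<open>The weights are distances in \<Gamma> themselves, so the triangle inequality applies
  whatever the edges of the walk are.\<close>

lemma walk_vertex_hop_dist:
  assumes "walk E u xs v" "x \<in> set xs"
  shows "hop_dist \<Gamma> u x \<le> walk_weight (hop_dist \<Gamma>) xs"
  using assms
proof (induction xs arbitrary: u rule: induct_list012)
  case (3 y z zs)
  show ?case
  proof (cases "x = y")
    case False
    then have "hop_dist \<Gamma> z x \<le> walk_weight (hop_dist \<Gamma>) (z # zs)" using 3 by auto
    then show ?thesis
      using hop_dist_triangle[of \<Gamma> y x z] 3 by (auto intro: order_trans add_left_mono)
  qed (use 3 in auto)
qed auto

lemma solution_walk_near_conflict: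
  assumes "simple_graph n E"
    and "conflict T \<Gamma> E u v" "walk F u xs v" "walk_weight (hop_dist \<Gamma>) xs \<le> enat T" "x \<in> set xs"
  shows "\<exists>y z. conflict T \<Gamma> E y z \<and> hop_dist E y x \<le> enat (T * T)"
proof -
  have "hop_dist \<Gamma> u x \<le> enat T"
    using walk_vertex_hop_dist[OF assms(3,5), of \<Gamma>] assms(4) by simp
  then obtain ys where ys: "walk \<Gamma> u ys x" "walk_weight (\<lambda>_ _. 1) ys \<le> enat T"
    unfolding hop_dist_def wd_le_iff by blast
  obtain y z where yz: "conflict T \<Gamma> E y z" "hop_dist E y x \<le> 0 + enat T * walk_weight (\<lambda>_ _. 1) ys"
    using near_conflict[OF assms(1) ys(1) assms(2), of 0] by auto
  have "enat T * walk_weight (\<lambda>_ _. 1) ys \<le> enat T * enat T"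
    using ys(2) by (intro mult_left_mono) auto
  then show ?thesis using yz order_trans by fastforce
qed

text \<open>An edge of \<Gamma> that is not in conflict needs no help from \<open>S\<close>. For an
  edge in conflict the whole repairing walk lies in \<open>K\<close>, so the pairs of
  \<open>S\<close> on it have both ends in \<open>K\<close>.\<close>

lemma solution_restrict:
  assumes "simple_graph n E" "simple_graph n \<Gamma>"
    and sol: "\<And>u v. {u, v} \<in> \<Gamma> \<Longrightarrow> weighted_dist (hop_dist \<Gamma>) (E \<union> S) u v \<le> enat T"
    and K: "\<And>x y z. x < n \<Longrightarrow> conflict T \<Gamma> E y z \<Longrightarrow> hop_dist E y x \<le> enat (T * T) \<Longrightarrow> x \<in> K"
    and S: "S \<subseteq> Pow {..<n}"
    and uv: "{u, v} \<in> \<Gamma>"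
  shows "weighted_dist (hop_dist \<Gamma>) (E \<union> {e \<in> S. e \<subseteq> K}) u v \<le> enat T"
proof (cases "conflict T \<Gamma> E u v")
  case True
  obtain xs where xs: "walk (E \<union> S) u xs v" "walk_weight (hop_dist \<Gamma>) xs \<le> enat T"
    using sol[OF uv] unfolding wd_le_iff by blast
  have "u < n" using edge_neq[OF assms(2) uv] by simp
  then have "set xs \<subseteq> {..<n}"
    using walk_vertices[OF xs(1)] S simple_graph_Pow[OF assms(1)] by auto
  then have "set xs \<subseteq> K"
    using solution_walk_near_conflict[OF assms(1) True xs] K by blast
  moreover have "walk (E \<union> {e \<in> S. e \<subseteq> K}) u ys v" if "walk (E \<union> S) u ys v" "set ys \<subseteq> K" for u ys
    using that by (induction ys arbitrary: u rule: induct_list012) auto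
  ultimately have "walk (E \<union> {e \<in> S. e \<subseteq> K}) u xs v" using xs(1) by blast
  then show ?thesis using xs(2) unfolding wd_le_iff by blast
next
  case False
  then show ?thesis
    using uv wd_mono[of E "E \<union> {e \<in> S. e \<subseteq> K}" "hop_dist \<Gamma>" u v]
    by (auto simp: conflict_def)
qed

text \<open>Take for \<open>p\<close> the vertex at which the walk first uses a pair of
  \<open>S\<close>. Up to there it consists of edges of \<open>E\<close>, each of weight at least
  1.\<close>

lemma solution_endpoint_near:
  assumes "simple_graph n E"
    and "walk (E \<union> S) u xs v" "\<not> walk E u xs v" "\<And>x y. {x, y} \<in> S \<Longrightarrow> x \<noteq> y"
  shows "\<exists>p\<in>\<Union>S. hop_dist E u p \<le> walk_weight (hop_dist \<Gamma>) xs"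
  using assms(2,3)
proof (induction xs arbitrary: u rule: induct_list012)
  case (3 x y zs)
  show ?case
  proof (cases "{x, y} \<in> S")
    case True
    then show ?thesis using 3 by (intro bexI[of _ x]) auto
  next
    case False
    then have E: "{x, y} \<in> E" "x = u" using 3 by auto
    with 3 have "walk (E \<union> S) y (y # zs) v" "\<not> walk E y (y # zs) v" by auto
    from "3.IH"(2)[OF this] obtain p
      where p: "p \<in> \<Union>S" "hop_dist E y p \<le> walk_weight (hop_dist \<Gamma>) (y # zs)" by blast
    have "hop_dist E x y \<le> hop_dist \<Gamma> x y"
      using hop_dist_edge[OF E(1)] one_le_hop_dist edge_neq[OF assms(1) E(1)] order_trans by blast
    then have "hop_dist E x p \<le> hop_dist \<Gamma> x y + walk_weight (hop_dist \<Gamma>) (y # zs)"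
      using hop_dist_triangle[of E x p y] p(2) by (meson add_mono order_trans)
    then show ?thesis using E p by auto
  qed
qed auto

lemma card_Union_edges:
  assumes "finite S" "\<And>e. e \<in> S \<Longrightarrow> card e \<le> 2"
  shows "card (\<Union>S) \<le> 2 * card S"
proof -
  have "card (\<Union>S) \<le> (\<Sum>e\<in>S. card e)" by (rule card_Union_le_sum_card)
  also have "\<dots> \<le> (\<Sum>e\<in>S. 2)" using assms by (intro sum_mono) auto
  finally show ?thesis by simp
qed

lemma all_pairsE:
  assumes "e \<in> all_pairs n" obtains u v where "e = {u, v}" "u < n" "v < n" "u \<noteq> v"
  using assms unfolding all_pairs_def by blast

lemma finite_all_pairs [simp]: "finite (all_pairs n)"
  by (rule finite_subset[of _ "Pow {..<n}"]) (auto simp: all_pairs_def)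

text \<open>
  Each conflict vertex is within \<open>T\<close> steps of an end of \<open>S\<close>; so among any \<open>2|S| + 1\<close> of them two
  are within \<open>2T\<close> steps of each other.
\<close>

lemma solution_card_centers:
  assumes "simple_graph n E" "simple_graph n \<Gamma>" "S \<subseteq> all_pairs n"
    and sol: "\<And>u v. {u, v} \<in> \<Gamma> \<Longrightarrow> weighted_dist (hop_dist \<Gamma>) (E \<union> S) u v \<le> enat T"
    and C: "\<And>c. c \<in> C \<Longrightarrow> \<exists>v. conflict T \<Gamma> E c v"
    and far: "\<And>c c'. c \<in> C \<Longrightarrow> c' \<in> C \<Longrightarrow> c \<noteq> c' \<Longrightarrow> \<not> hop_dist E c c' \<le> enat (2 * T)"
  shows "card C \<le> 2 * card S"
proof -
  have fin: "finite S" using assms(3) finite_all_pairs by (rule finite_subset)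
  have card2: "card e \<le> 2" if "e \<in> S" for e
    using that assms(3) by (auto elim!: all_pairsE dest!: subsetD)
  have finU: "finite (\<Union>S)" using assms(3) by (intro finite_Union fin) (auto elim!: all_pairsE dest!: subsetD)
  have "\<exists>p\<in>\<Union>S. hop_dist E c p \<le> enat T" if c: "c \<in> C" for c
  proof -
    obtain v where v: "conflict T \<Gamma> E c v" using C[OF c] by blast
    then obtain xs where xs: "walk (E \<union> S) c xs v" "walk_weight (hop_dist \<Gamma>) xs \<le> enat T"
      using sol[of c v] unfolding wd_le_iff conflict_def by blast
    have "\<not> walk E c xs v" using v xs(2) unfolding conflict_def wd_le_iff by blast
    moreover have "x \<noteq> y" if "{x, y} \<in> S" for x y
      using that assms(3) edge_neq[of n S] by (auto simp: simple_graph_def)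
    ultimately show ?thesis
      using solution_endpoint_near[OF assms(1) xs(1), of \<Gamma>] xs(2) order_trans by meson
  qed
  then obtain p where p: "\<And>c. c \<in> C \<Longrightarrow> p c \<in> \<Union>S" "\<And>c. c \<in> C \<Longrightarrow> hop_dist E c (p c) \<le> enat T"
    by metis
  have "inj_on p C"
  proof (rule inj_onI, rule ccontr)
    fix c c' assume c: "c \<in> C" "c' \<in> C" "p c = p c'" "c \<noteq> c'"
    have "hop_dist E c c' \<le> enat T + enat T"
      using hop_dist_triangle[of E c c' "p c"] p(2)[OF c(1)] p(2)[OF c(2)] hop_dist_commute[of E c' "p c"] c(3)
      by (metis add_mono order_trans)
    then show False using far[OF c(1,2,4)] by (simp add: mult_2)
  qed
  then have "card C \<le> card (\<Union>S)" using p(1) finU by (intro card_inj_on_le[of p]) auto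
  also have "\<dots> \<le> 2 * card S" using card_Union_edges[OF fin card2] .
  finally show ?thesis .
qed

section \<open>The size of balls in terms of the maximum degree\<close>

lemma neighbours_bound:
  assumes "simple_graph n E" "u < n"
  shows "card {v. {u, v} \<in> E} \<le> max_degree n E" "finite {v. {u, v} \<in> E}"
proof -
  have fin: "finite E" using assms(1) finite_all_pairs unfolding simple_graph_def by (rule finite_subset)
  have "card {v. {u, v} \<in> E} \<le> card {e \<in> E. u \<in> e}"
    using fin by (intro card_inj_on_le[of "\<lambda>v. {u, v}"]) (auto simp: inj_on_def doubleton_eq_iff)
  also have "\<dots> \<le> max_degree n E"
    unfolding max_degree_def degree_def[symmetric] using assms(2) by (intro Max_ge) auto
  finally show "card {v. {u, v} \<in> E} \<le> max_degree n E" .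
  show "finite {v. {u, v} \<in> E}"
    by (rule finite_subset[of _ "{..<n}"]) (use edge_neq[OF assms(1)] in auto)
qed

lemma hop_ball_step:
  assumes "hop_dist E u v \<le> enat r"
  obtains "v = u" | y r' where "{u, y} \<in> E" "r = Suc r'" "hop_dist E y v \<le> enat r'"
proof -
  obtain xs where xs: "walk E u xs v" "walk_weight (\<lambda>_ _. 1) xs \<le> enat r"
    using assms unfolding hop_dist_def wd_le_iff by blast
  show thesis
  proof (cases xs rule: remdups_adj.cases)
    case (3 x y zs)
    obtain r' where r: "r = Suc r'" using xs(2) 3
      by (cases r) (auto simp: zero_enat_def[symmetric] add_eq_0_iff_both_eq_0)
    then have "1 + walk_weight (\<lambda>_ _. 1) (y # zs) \<le> 1 + enat r'"
      using xs(2) 3 by (simp add: one_enat_def)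
    then have "walk_weight (\<lambda>_ _. 1) (y # zs) \<le> enat r'"
      by (cases "walk_weight (\<lambda>_ _. 1::enat) (y # zs)") (auto simp: one_enat_def)
    then have "hop_dist E y v \<le> enat r'"
      using xs(1) 3 unfolding hop_dist_def wd_le_iff by auto
    then show ?thesis using that(2)[of y r'] xs(1) 3 r by auto
  qed (use xs that in auto)
qed

text \<open>For \<open>D = 1\<close> the bound may not grow with \<open>r\<close>: components are
  single vertices or single edges, so a ball has at most 2 vertices. For \<open>D \<ge> 2\<close>
  the induction works with one vertex to spare, as 1 + D * (D^(r+1) - 1) + 1 is at most D^(r+2). The
  factor 2 in the statement covers the first case.\<close>

lemma hop_ball_bound:
  assumes "simple_graph n E" "u < n" "D = max 1 (max_degree n E)"
  shows "finite {v. hop_dist E u v \<le> enat r} \<and> card {v. hop_dist E u v \<le> enat r} \<le> 2 * D ^ (r + 1)"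
proof (cases "D = 1")
  case True
  have sub: "v = u \<or> {u, v} \<in> E" if "hop_dist E u v \<le> enat r" for u v
    using that
  proof (induction r arbitrary: u)
    case 0
    then show ?case by (cases rule: hop_ball_step) auto
  next
    case (Suc r)
    from Suc.prems show ?case
    proof (cases rule: hop_ball_step)
      case (2 y r')
      then consider "v = y" | "{y, v} \<in> E" using Suc.IH[of y] by auto
      then show ?thesis
      proof cases
        case 2
        have y: "y < n" "{y, u} \<in> E"
          using edge_neq[OF assms(1) \<open>{u, y} \<in> E\<close>] \<open>{u, y} \<in> E\<close> by (auto simp: insert_commute)
        have "card {v. {y, v} \<in> E} \<le> 1"
          using neighbours_bound(1)[OF assms(1) y(1)] assms(3) True by simp
        then have "u = v"
          using neighbours_bound(2)[OF assms(1) y(1)] y(2) 2 by (auto simp: card_le_Suc0_iff_eq)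
        then show ?thesis by simp
      qed (use 2 in auto)
    qed auto
  qed
  have "card {v. {u, v} \<in> E} \<le> 1"
    using neighbours_bound(1)[OF assms(1,2)] assms(3) True by linarith
  then have "card (insert u {v. {u, v} \<in> E}) \<le> 2"
    using neighbours_bound(2)[OF assms(1,2)] by (simp add: card_insert_if)
  moreover have sub': "{v. hop_dist E u v \<le> enat r} \<subseteq> insert u {v. {u, v} \<in> E}"
    using sub by auto
  moreover have fin: "finite (insert u {v. {u, v} \<in> E})"
    using neighbours_bound(2)[OF assms(1,2)] by simp
  ultimately have "card {v. hop_dist E u v \<le> enat r} \<le> 2"
    using card_mono[OF fin sub'] by linarith
  then show ?thesis using True finite_subset[OF sub' fin] by simp
next
  case False
  then have D: "2 \<le> D" using assms(3) by auto
  have "finite {v. hop_dist E u v \<le> enat r} \<and> card {v. hop_dist E u v \<le> enat r} + 1 \<le> D ^ (r + 1)"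
    using assms(2)
  proof (induction r arbitrary: u)
    case 0
    have "v = u" if "hop_dist E u v \<le> enat 0" for v
      using that by (cases rule: hop_ball_step) auto
    then have "{v. hop_dist E u v \<le> enat 0} = {u}" by auto
    then show ?case using D by simp
  next
    case (Suc r)
    let ?B = "\<lambda>y. {v. hop_dist E y v \<le> enat r}" and ?N = "{y. {u, y} \<in> E}"
    have N: "finite ?N" "card ?N \<le> D" using neighbours_bound[OF assms(1) Suc.prems] assms(3) by auto
    have B: "finite (?B y) \<and> card (?B y) \<le> D ^ (r + 1) - 1" if "y \<in> ?N" for y
      using Suc.IH[of y] that edge_neq[OF assms(1)] by force
    have sub: "{v. hop_dist E u v \<le> enat (Suc r)} \<subseteq> insert u (\<Union>y\<in>?N. ?B y)"
    proof
      fix v assume "v \<in> {v. hop_dist E u v \<le> enat (Suc r)}"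
      then have "hop_dist E u v \<le> enat (Suc r)" by simp
      then show "v \<in> insert u (\<Union>y\<in>?N. ?B y)" by (cases rule: hop_ball_step) auto
    qed
    have fin: "finite (insert u (\<Union>y\<in>?N. ?B y))" using N B by blast
    have "card (insert u (\<Union>y\<in>?N. ?B y)) \<le> 1 + D * (D ^ (r + 1) - 1)"
    proof -
      have "card (insert u (\<Union>y\<in>?N. ?B y)) \<le> 1 + card (\<Union>y\<in>?N. ?B y)"
        using fin by (simp add: card_insert_if del: UN_simps)
      also have "card (\<Union>y\<in>?N. ?B y) \<le> (\<Sum>y\<in>?N. card (?B y))" using N(1) by (rule card_UN_le)
      also have "\<dots> \<le> (\<Sum>y\<in>?N. D ^ (r + 1) - 1)" using B by (intro sum_mono) auto
      also have "\<dots> \<le> D * (D ^ (r + 1) - 1)" using N(2) by (simp add: mult_right_mono)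
      finally show ?thesis by simp
    qed
    moreover have "1 + D * (D ^ (r + 1) - 1) + 1 \<le> D ^ (Suc r + 1)"
    proof -
      obtain q where "D ^ (r + 1) = Suc q" using D by (metis gr0_conv_Suc zero_less_power pos2 order_less_le_trans)
      then show ?thesis using D by simp
    qed
    ultimately show ?case
      using card_mono[OF fin sub] finite_subset[OF sub fin] by linarith
  qed
  then show ?thesis by auto
qed

section \<open>Weakest preconditions with time\<close>

text \<open>
  Total correctness including the running time. As evaluation is deterministic, the rules are
  equations, and the simplifier executes the body of a function symbolically up to the next call.
\<close>

definition wp :: "program \<Rightarrow> tree list \<Rightarrow> exp \<Rightarrow> (tree \<Rightarrow> nat \<Rightarrow> bool) \<Rightarrow> bool" where
  "wp P env e Q \<longleftrightarrow> (\<exists>v T. eval P env e v T \<and> Q v T)"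

definition wps :: "program \<Rightarrow> tree list \<Rightarrow> exp list \<Rightarrow> (tree list \<Rightarrow> nat \<Rightarrow> bool) \<Rightarrow> bool" where
  "wps P env es Q \<longleftrightarrow> (\<exists>vs T. evals P env es vs T \<and> Q vs T)"

definition wp_call :: "program \<Rightarrow> nat \<Rightarrow> tree list \<Rightarrow> (tree \<Rightarrow> nat \<Rightarrow> bool) \<Rightarrow> bool" where
  "wp_call P f vs Q \<longleftrightarrow> f < length P \<and> wp P vs (P ! f) Q"

definition computes :: "program \<Rightarrow> nat \<Rightarrow> tree list \<Rightarrow> tree \<Rightarrow> nat \<Rightarrow> bool" where
  "computes P f vs v B \<longleftrightarrow> wp_call P f vs (\<lambda>w T. w = v \<and> T \<le> B)"

inductive_simps eval_iffs:
  "eval P env (Arg i) v T" "eval P env (Quote x) v T" "eval P env (Mk_Node a b) v T"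
  "eval P env (First a) v T" "eval P env (Second a) v T" "eval P env (Ite a b c) v T"
  "eval P env (Bind a b) v T" "eval P env (Call f es) v T"
inductive_simps evals_iffs: "evals P env [] vs T" "evals P env (e # es) vs T"

lemma wp_iffs:
  "wp P env (Arg i) Q \<longleftrightarrow> i < length env \<and> Q (env ! i) 1"
  "wp P env (Quote v) Q \<longleftrightarrow> Q v 1"
  "wp P env (Mk_Node a b) Q \<longleftrightarrow> wp P env a (\<lambda>v T. wp P env b (\<lambda>w U. Q (Node v w) (T + U + 1)))"
  "wp P env (First a) Q \<longleftrightarrow> wp P env a (\<lambda>v T. Q (first v) (T + 1))"
  "wp P env (Second a) Q \<longleftrightarrow> wp P env a (\<lambda>v T. Q (second v) (T + 1))"
  "wp P env (Ite a b c) Q \<longleftrightarrow>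
     wp P env a (\<lambda>v T. wp P env (if v = Leaf then c else b) (\<lambda>w U. Q w (T + U + 1)))"
  "wp P env (Bind a b) Q \<longleftrightarrow> wp P env a (\<lambda>v T. wp P (v # env) b (\<lambda>w U. Q w (T + U + 1)))"
  "wp P env (Call f es) Q \<longleftrightarrow>
     wps P env es (\<lambda>vs T. wp_call P f vs (\<lambda>w U. Q w (T + U + 1)))"
  unfolding wp_def wps_def wp_call_def eval_iffs evals_iffs
  by (fastforce split: if_splits)+

lemma wps_iffs:
  "wps P env [] Q \<longleftrightarrow> Q [] 0"
  "wps P env (e # es) Q \<longleftrightarrow> wp P env e (\<lambda>v T. wps P env es (\<lambda>vs U. Q (v # vs) (T + U)))"
  unfolding wp_def wps_def wp_call_def eval_iffs evals_iffs
  by (fastforce split: if_splits)+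


lemmas wp_simps = wp_iffs wps_iffs

lemma wp_callI:
  assumes "computes P f vs v B" "\<And>T. T \<le> B \<Longrightarrow> Q v T" shows "wp_call P f vs Q"
  using assms unfolding computes_def wp_call_def wp_def by blast

lemma computes_mono: "computes P f vs v B \<Longrightarrow> B \<le> C \<Longrightarrow> computes P f vs v C"
  unfolding computes_def wp_call_def wp_def by (blast intro: order_trans)

section \<open>The program\<close>

abbreviation "tree_True \<equiv> Node Leaf Leaf"

text \<open>The only test of the language is whether a tree is a leaf. Shifting finite values by one
  frees the leaf for \<infinity>.\<close>

definition tree_of_enat :: "enat \<Rightarrow> tree" where
  "tree_of_enat x = (case x of enat m \<Rightarrow> tree_of_nat (Suc m) | \<infinity> \<Rightarrow> Leaf)"

abbreviation tree_of_nats :: "nat list \<Rightarrow> tree" where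
  "tree_of_nats xs \<equiv> tree_of_list (map tree_of_nat xs)"

definition "f_main = (0 :: nat)"
definition "f_leq = (1 :: nat)"
definition "f_app = (2 :: nat)"
definition "f_nth = (3 :: nat)"
definition "f_inS = (4 :: nat)"
definition "f_eq = (5 :: nat)"
definition "f_edge = (6 :: nat)"
definition "f_wt = (7 :: nat)"
definition "f_add = (8 :: nat)"
definition "f_min = (9 :: nat)"
definition "f_loop = (10 :: nat)"
definition "f_step = (11 :: nat)"
definition "f_iter = (12 :: nat)"
definition "f_init = (13 :: nat)"
definition "f_dist = (14 :: nat)"
definition "f_within = (15 :: nat)"
definition "f_row_ok = (16 :: nat)"
definition "f_ok = (17 :: nat)"
definition "f_near = (18 :: nat)"
definition "f_greedy = (19 :: nat)"
definition "f_cands = (20 :: nat)"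
definition "f_search = (21 :: nat)"
definition "f_try = (22 :: nat)"
definition "f_verts = (23 :: nat)"

text \<open>In the innermost body the environment is 2k, centers, vertices, \<open>G\<close>,
  \<Gamma>, k. The number 2k serves both as the limit on the centers and as the length of the flat
  list of ends of k pairs. The list of centers can be compared with it directly, as a unary number
  is a list.\<close>

definition "b_main =
  Bind (Call f_verts [Arg 0, Quote Leaf])
   (Bind (Call f_greedy [Arg 0, Quote Leaf, Arg 0, Arg 1, Arg 2])
     (Bind (Call f_app [Arg 4, Arg 4])
       (Ite (Call f_leq [Arg 1, Arg 0])
         (Call f_search [Arg 0, Quote Leaf, Call f_cands [Arg 2, Arg 1, Arg 2, Arg 3], Arg 2, Arg 3, Arg 4])
         (Quote Leaf))))"
definition "b_leq =
  Ite (Arg 0)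
    (Ite (Arg 1) (Call f_leq [Second (Arg 0), Second (Arg 1)]) (Quote Leaf))
    (Quote tree_True)"
definition "b_app = Ite (Arg 0) (Mk_Node (First (Arg 0)) (Call f_app [Second (Arg 0), Arg 1])) (Arg 1)"
definition "b_nth = Ite (Arg 1) (Call f_nth [Second (Arg 0), Second (Arg 1)]) (First (Arg 0))"
definition "b_inS =
  Ite (Arg 0)
    (Ite (Second (Arg 0))
      (Ite (Ite (Call f_eq [Arg 1, First (Arg 0)]) (Call f_eq [Arg 2, First (Second (Arg 0))]) (Quote Leaf))
        (Quote tree_True)
        (Call f_inS [Second (Second (Arg 0)), Arg 1, Arg 2]))
      (Quote Leaf))
    (Quote Leaf)"
definition "b_eq = Ite (Call f_leq [Arg 0, Arg 1]) (Call f_leq [Arg 1, Arg 0]) (Quote Leaf)"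
definition "b_edge =
  Ite (Call f_nth [Call f_nth [Arg 2, Arg 0], Arg 1])
    (Quote tree_True)
    (Ite (Call f_inS [Arg 3, Arg 0, Arg 1]) (Quote tree_True) (Call f_inS [Arg 3, Arg 1, Arg 0]))"
text \<open>
  A leaf as the last argument selects unit weights, which gives the hop distance; otherwise it is
  the matrix of \<open>\<Gamma>\<close>, which provides the weights.
\<close>

definition "b_wt =
  Ite (Call f_eq [Arg 0, Arg 1])
    (Quote (tree_of_enat 0))
    (Ite (Call f_edge [Arg 0, Arg 1, Arg 3, Arg 4])
      (Ite (Arg 5)
        (Call f_dist [Arg 0, Arg 1, Arg 2, Arg 5, Quote Leaf, Quote Leaf])
        (Quote (tree_of_enat 1)))
      (Quote Leaf))"
definition "b_add =
  Ite (Arg 0) (Ite (Arg 1) (Call f_app [Arg 0, Second (Arg 1)]) (Quote Leaf)) (Quote Leaf)"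
definition "b_min =
  Ite (Arg 0) (Ite (Arg 1) (Ite (Call f_leq [Arg 0, Arg 1]) (Arg 0) (Arg 1)) (Arg 0)) (Arg 1)"
definition "b_loop =
  Ite (Arg 0)
    (Call f_min
      [Call f_add [Call f_wt [Arg 2, First (Arg 0), Arg 3, Arg 4, Arg 5, Arg 6], First (Arg 1)],
       Call f_loop [Second (Arg 0), Second (Arg 1), Arg 2, Arg 3, Arg 4, Arg 5, Arg 6]])
    (Quote Leaf)"
definition "b_step =
  Ite (Arg 0)
    (Mk_Node (Call f_loop [Arg 2, Arg 1, First (Arg 0), Arg 2, Arg 3, Arg 4, Arg 5])
      (Call f_step [Second (Arg 0), Arg 1, Arg 2, Arg 3, Arg 4, Arg 5]))
    (Quote Leaf)"
definition "b_iter =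
  Ite (Arg 0)
    (Call f_iter
      [Second (Arg 0), Call f_step [Arg 2, Arg 1, Arg 2, Arg 3, Arg 4, Arg 5], Arg 2, Arg 3, Arg 4, Arg 5])
    (Arg 1)"
definition "b_init =
  Ite (Arg 0)
    (Mk_Node (Ite (Call f_eq [First (Arg 0), Arg 1]) (Quote (tree_of_enat 0)) (Quote Leaf))
      (Call f_init [Second (Arg 0), Arg 1]))
    (Quote Leaf)"
text \<open>The recursion through \<open>f_wt\<close> is only two levels deep: a weight is a hop
  distance in \<Gamma>, which is computed with unit weights and asks for no further
  distances.\<close>

definition "b_dist =
  Call f_nth
    [Call f_iter [Arg 2, Call f_init [Arg 2, Arg 1], Arg 2, Arg 3, Arg 4, Arg 5], Arg 0]"
definition "b_within = Ite (Arg 0) (Call f_leq [Second (Arg 0), Arg 1]) (Quote Leaf)"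
text \<open>There is one program for each \<open>T\<close>. Being quoted, the thresholds
  \<open>T\<close>, \<open>2 * T\<close> and \<open>T * T + 2 * T\<close> take one step each,
  however large they are.\<close>

definition "b_row_ok T =
  Ite (Arg 0)
    (Ite (Call f_nth [Call f_nth [Arg 5, Arg 1], First (Arg 0)])
      (Ite (Call f_within
            [Call f_dist [Arg 1, First (Arg 0), Arg 2, Arg 3, Arg 4, Arg 5], Quote (tree_of_nat T)])
        (Call f_row_ok [Second (Arg 0), Arg 1, Arg 2, Arg 3, Arg 4, Arg 5])
        (Quote Leaf))
      (Call f_row_ok [Second (Arg 0), Arg 1, Arg 2, Arg 3, Arg 4, Arg 5]))
    (Quote tree_True)"
definition "b_ok =
  Ite (Arg 0)
    (Ite (Call f_row_ok [Arg 1, First (Arg 0), Arg 1, Arg 2, Arg 3, Arg 4])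
      (Call f_ok [Second (Arg 0), Arg 1, Arg 2, Arg 3, Arg 4])
      (Quote Leaf))
    (Quote tree_True)"
definition "b_near =
  Ite (Arg 0)
    (Ite (Call f_within [Call f_dist [First (Arg 0), Arg 1, Arg 3, Arg 4, Quote Leaf, Quote Leaf], Arg 2])
      (Quote tree_True)
      (Call f_near [Second (Arg 0), Arg 1, Arg 2, Arg 3, Arg 4]))
    (Quote Leaf)"
definition "b_greedy T =
  Ite (Arg 0)
    (Call f_greedy
      [Second (Arg 0),
       Ite (Call f_row_ok [Arg 2, First (Arg 0), Arg 2, Arg 3, Quote Leaf, Arg 4])
         (Arg 1)
         (Ite (Call f_near [Arg 1, First (Arg 0), Quote (tree_of_nat (2 * T)), Arg 2, Arg 3])
           (Arg 1)
           (Mk_Node (First (Arg 0)) (Arg 1))),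
       Arg 2, Arg 3, Arg 4])
    (Arg 1)"
definition "b_cands T =
  Ite (Arg 0)
    (Ite (Call f_near [Arg 1, First (Arg 0), Quote (tree_of_nat (T * T + 2 * T)), Arg 2, Arg 3])
      (Mk_Node (First (Arg 0)) (Call f_cands [Second (Arg 0), Arg 1, Arg 2, Arg 3]))
      (Call f_cands [Second (Arg 0), Arg 1, Arg 2, Arg 3]))
    (Quote Leaf)"
text \<open>The current list is tested before it is extended, so lists of every length up to the
  limit are tried. In a list of odd length \<open>f_inS\<close> ignores the vertex left over at the
  end.\<close>

definition "b_search =
  Ite (Call f_ok [Arg 3, Arg 3, Arg 4, Arg 1, Arg 5])
    (Quote tree_True)
    (Ite (Arg 0)
      (Call f_try [Arg 2, Arg 0, Arg 1, Arg 2, Arg 3, Arg 4, Arg 5])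
      (Quote Leaf))"
definition "b_try =
  Ite (Arg 0)
    (Ite (Call f_search [Second (Arg 1), Mk_Node (First (Arg 0)) (Arg 2), Arg 3, Arg 4, Arg 5, Arg 6])
      (Quote tree_True)
      (Call f_try [Second (Arg 0), Arg 1, Arg 2, Arg 3, Arg 4, Arg 5, Arg 6]))
    (Quote Leaf)"
definition "b_verts =
  Ite (Arg 0)
    (Mk_Node (Arg 1) (Call f_verts [Second (Arg 0), Mk_Node (Quote Leaf) (Arg 1)]))
    (Quote Leaf)"

definition prog :: "nat \<Rightarrow> program" where
  "prog T = [b_main, b_leq, b_app, b_nth, b_inS, b_eq, b_edge, b_wt, b_add, b_min, b_loop, b_step,
     b_iter, b_init, b_dist, b_within, b_row_ok T, b_ok, b_near, b_greedy T, b_cands T, b_search,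
     b_try, b_verts]"

lemmas function_defs = f_main_def f_leq_def f_app_def f_nth_def f_inS_def f_eq_def
  f_edge_def f_wt_def f_add_def f_min_def f_loop_def f_step_def f_iter_def f_init_def
  f_dist_def f_within_def f_row_ok_def f_ok_def f_near_def f_greedy_def f_cands_def
  f_search_def f_try_def f_verts_def

text \<open>Resolution selects the clause by the function number, so the table of bodies is
  consulted only here.\<close>

lemma prog_computesI:
  "wp (prog T) vs b_main (\<lambda>w U. w = v \<and> U \<le> B) \<Longrightarrow> computes (prog T) f_main vs v B"
  "wp (prog T) vs b_leq (\<lambda>w U. w = v \<and> U \<le> B) \<Longrightarrow> computes (prog T) f_leq vs v B"
  "wp (prog T) vs b_app (\<lambda>w U. w = v \<and> U \<le> B) \<Longrightarrow> computes (prog T) f_app vs v B"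
  "wp (prog T) vs b_nth (\<lambda>w U. w = v \<and> U \<le> B) \<Longrightarrow> computes (prog T) f_nth vs v B"
  "wp (prog T) vs b_inS (\<lambda>w U. w = v \<and> U \<le> B) \<Longrightarrow> computes (prog T) f_inS vs v B"
  "wp (prog T) vs b_eq (\<lambda>w U. w = v \<and> U \<le> B) \<Longrightarrow> computes (prog T) f_eq vs v B"
  "wp (prog T) vs b_edge (\<lambda>w U. w = v \<and> U \<le> B) \<Longrightarrow> computes (prog T) f_edge vs v B"
  "wp (prog T) vs b_wt (\<lambda>w U. w = v \<and> U \<le> B) \<Longrightarrow> computes (prog T) f_wt vs v B"
  "wp (prog T) vs b_add (\<lambda>w U. w = v \<and> U \<le> B) \<Longrightarrow> computes (prog T) f_add vs v B"
  "wp (prog T) vs b_min (\<lambda>w U. w = v \<and> U \<le> B) \<Longrightarrow> computes (prog T) f_min vs v B"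
  "wp (prog T) vs b_loop (\<lambda>w U. w = v \<and> U \<le> B) \<Longrightarrow> computes (prog T) f_loop vs v B"
  "wp (prog T) vs b_step (\<lambda>w U. w = v \<and> U \<le> B) \<Longrightarrow> computes (prog T) f_step vs v B"
  "wp (prog T) vs b_iter (\<lambda>w U. w = v \<and> U \<le> B) \<Longrightarrow> computes (prog T) f_iter vs v B"
  "wp (prog T) vs b_init (\<lambda>w U. w = v \<and> U \<le> B) \<Longrightarrow> computes (prog T) f_init vs v B"
  "wp (prog T) vs b_dist (\<lambda>w U. w = v \<and> U \<le> B) \<Longrightarrow> computes (prog T) f_dist vs v B"
  "wp (prog T) vs b_within (\<lambda>w U. w = v \<and> U \<le> B) \<Longrightarrow> computes (prog T) f_within vs v B"
  "wp (prog T) vs (b_row_ok T) (\<lambda>w U. w = v \<and> U \<le> B) \<Longrightarrow> computes (prog T) f_row_ok vs v B"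
  "wp (prog T) vs b_ok (\<lambda>w U. w = v \<and> U \<le> B) \<Longrightarrow> computes (prog T) f_ok vs v B"
  "wp (prog T) vs b_near (\<lambda>w U. w = v \<and> U \<le> B) \<Longrightarrow> computes (prog T) f_near vs v B"
  "wp (prog T) vs (b_greedy T) (\<lambda>w U. w = v \<and> U \<le> B) \<Longrightarrow> computes (prog T) f_greedy vs v B"
  "wp (prog T) vs (b_cands T) (\<lambda>w U. w = v \<and> U \<le> B) \<Longrightarrow> computes (prog T) f_cands vs v B"
  "wp (prog T) vs b_search (\<lambda>w U. w = v \<and> U \<le> B) \<Longrightarrow> computes (prog T) f_search vs v B"
  "wp (prog T) vs b_try (\<lambda>w U. w = v \<and> U \<le> B) \<Longrightarrow> computes (prog T) f_try vs v B"
  "wp (prog T) vs b_verts (\<lambda>w U. w = v \<and> U \<le> B) \<Longrightarrow> computes (prog T) f_verts vs v B"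
  unfolding computes_def wp_call_def prog_def function_defs by simp_all

section \<open>Lists, numbers and edges\<close>

lemma tree_of_list_eq_Leaf [simp]: "tree_of_list xs = Leaf \<longleftrightarrow> xs = []"
  by (cases xs) auto

lemma tree_of_nat_0 [simp]: "tree_of_nat 0 = Leaf"
  and tree_of_nat_Suc: "tree_of_nat (Suc k) = Node Leaf (tree_of_nat k)"
  by (simp_all add: tree_of_nat_def)

lemma tree_of_nat_eq_Leaf [simp]: "tree_of_nat k = Leaf \<longleftrightarrow> k = 0"
  by (cases k) (auto simp: tree_of_nat_Suc)

lemma tree_of_bool_eq_Leaf [simp]: "tree_of_bool b = Leaf \<longleftrightarrow> \<not> b"
  by (simp add: tree_of_bool_def)

lemma tree_of_enat_eq_Leaf [simp]: "tree_of_enat x = Leaf \<longleftrightarrow> x = \<infinity>"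
  by (cases x) (auto simp: tree_of_enat_def)

lemma tree_of_enat_enat: "tree_of_enat (enat m) = tree_of_nat (Suc m)"
  and tree_of_enat_inf [simp]: "tree_of_enat \<infinity> = Leaf"
  by (simp_all add: tree_of_enat_def)

text \<open>Stated for arbitrary entries, as the list of centers is also compared with a number. The
  factor 20 generously rounds up the steps of one recursive call, here and in similar
  bounds.\<close>

lemma computes_leq_list:
  "computes (prog T) f_leq [tree_of_list xs, tree_of_list ys]
     (tree_of_bool (length xs \<le> length ys)) (20 * (length xs + 1))"
proof (induction xs arbitrary: ys)
  case Nil
  show ?case
    by (rule prog_computesI) (auto simp: b_leq_def wp_simps tree_of_bool_def)
next
  case (Cons x xs)
  show ?case
  proof (cases ys)
    case Nil
    then show ?thesis
      by (intro prog_computesI) (auto simp: b_leq_def wp_simps tree_of_bool_def)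
  next
    case (Cons y ys')
    show ?thesis unfolding Cons
      by (rule prog_computesI)
        (auto simp: b_leq_def wp_simps intro!: wp_callI[OF Cons.IH])
  qed
qed


lemma computes_leq:
  "computes (prog T) f_leq [tree_of_nat a, tree_of_nat b] (tree_of_bool (a \<le> b)) (20 * (a + 1))"
  using computes_leq_list[of T "replicate a Leaf" "replicate b Leaf"] by (simp add: tree_of_nat_def)

lemma computes_app_list:
  "computes (prog T) f_app [tree_of_list xs, tree_of_list ys] (tree_of_list (xs @ ys))
     (20 * (length xs + 1))"
proof (induction xs)
  case Nil
  show ?case by (rule prog_computesI) (auto simp: b_app_def wp_simps)
next
  case (Cons x xs)
  show ?case
    by (rule prog_computesI) (auto simp: b_app_def wp_simps intro!: wp_callI[OF Cons.IH])
qed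

lemma computes_app:
  "computes (prog T) f_app [tree_of_nat a, tree_of_nat b] (tree_of_nat (a + b)) (20 * (a + 1))"
  using computes_app_list[of T "replicate a Leaf" "replicate b Leaf"]
  by (simp add: tree_of_nat_def replicate_add)

lemma computes_nth:
  "i < length xs \<Longrightarrow>
   computes (prog T) f_nth [tree_of_list xs, tree_of_nat i] (xs ! i) (20 * (i + 1))"
proof (induction xs arbitrary: i)
  case (Cons x xs)
  show ?case
  proof (cases i)
    case 0
    then show ?thesis by (intro prog_computesI) (auto simp: b_nth_def wp_simps)
  next
    case (Suc j)
    then have "computes (prog T) f_nth [tree_of_list xs, tree_of_nat j] (xs ! j) (20 * (j + 1))"
      using Cons by simp
    then show ?thesis unfolding Suc
      by (intro prog_computesI) (auto simp: b_nth_def wp_simps tree_of_nat_Suc intro!: wp_callI)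
  qed
qed simp

lemma computes_eq:
  "computes (prog T) f_eq [tree_of_nat a, tree_of_nat b] (tree_of_bool (a = b)) (20 * (a + b + 3))"
  by (rule prog_computesI)
    (auto simp: b_eq_def wp_simps tree_of_bool_def intro!: wp_callI[OF computes_leq])

text \<open>The edges to be added are stored as a flat list of vertices, two consecutive ones for each edge.\<close>

fun listed_pairs :: "nat list \<Rightarrow> (nat \<times> nat) set" where
  "listed_pairs (a # b # xs) = insert (a, b) (listed_pairs xs)"
| "listed_pairs _ = {}"

definition listed_edges :: "nat list \<Rightarrow> nat set set" where
  "listed_edges S = {{a, b} | a b. (a, b) \<in> listed_pairs S}"

lemma computes_inS:
  "\<lbrakk>set S \<subseteq> {..m}; x \<le> m; y \<le> m\<rbrakk> \<Longrightarrow>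
   computes (prog T) f_inS [tree_of_nats S, tree_of_nat x, tree_of_nat y]
     (tree_of_bool ((x, y) \<in> listed_pairs S)) (Suc (length S) * (200 * (m + 1)))"
proof (induction S rule: listed_pairs.induct)
  case (1 a b S)
  have "computes (prog T) f_inS [tree_of_nats S, tree_of_nat x, tree_of_nat y]
     (tree_of_bool ((x, y) \<in> listed_pairs S)) (Suc (length S) * (200 * (m + 1)))"
    using 1 by simp
  then show ?case
    using 1(2-)
    by (intro prog_computesI)
      (auto simp: b_inS_def wp_simps tree_of_bool_def intro!: wp_callI[OF computes_eq] elim!: wp_callI)
qed (rule prog_computesI; auto simp: b_inS_def wp_simps tree_of_bool_def)+

lemma computes_graph_row:
  assumes "x < n"
  shows "computes (prog T) f_nth [tree_of_graph n E, tree_of_nat x]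
    (tree_of_list (map (\<lambda>v. tree_of_bool ({x, v} \<in> E)) [0..<n])) (20 * (x + 1))"
  unfolding tree_of_graph_def
  using computes_nth[of x "map (\<lambda>u. tree_of_list (map (\<lambda>v. tree_of_bool ({u, v} \<in> E)) [0..<n])) [0..<n]" T]
    assms by simp

lemma computes_row_entry:
  assumes "y < n"
  shows "computes (prog T) f_nth [tree_of_list (map (\<lambda>v. tree_of_bool ({x, v} \<in> E)) [0..<n]), tree_of_nat y]
    (tree_of_bool ({x, y} \<in> E)) (20 * (y + 1))"
  using computes_nth[of y "map (\<lambda>v. tree_of_bool ({x, v} \<in> E)) [0..<n]" T] assms by simp

lemma listed_edges_iff:
  "{x, y} \<in> listed_edges S \<longleftrightarrow> (x, y) \<in> listed_pairs S \<or> (y, x) \<in> listed_pairs S"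
  unfolding listed_edges_def by (auto simp: doubleton_eq_iff)

text \<open>Here and in the later costs, \<open>m\<close> bounds both the number of vertices and the
  length of \<open>S\<close>. The dominant terms are the two scans of \<open>S\<close>, one for each
  orientation of the pair.\<close>

definition "edge_cost m = 500 * (m + 1) * (m + 1)"

lemma computes_edge:
  assumes "set S \<subseteq> {..<n}" "length S \<le> m" "n \<le> m" "x < n" "y < n"
  shows "computes (prog T) f_edge [tree_of_nat x, tree_of_nat y, tree_of_graph n E, tree_of_nats S]
     (tree_of_bool ({x, y} \<in> E \<union> listed_edges S)) (edge_cost m)"
proof -
  have inS: "computes (prog T) f_inS [tree_of_nats S, tree_of_nat x, tree_of_nat y]
     (tree_of_bool ((x, y) \<in> listed_pairs S)) (Suc m * (200 * (m + 1)))"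
    if "x < n" "y < n" for x y
    by (rule computes_mono[OF computes_inS[where m = m]]) (use that assms in \<open>auto intro!: mult_le_mono1\<close>)
  have le: "40 * (m + 1) + 2 * (Suc m * (200 * (m + 1))) + 30 \<le> edge_cost m"
    unfolding edge_cost_def by (simp add: algebra_simps)
  show ?thesis
    by (rule prog_computesI)
      (use assms le in \<open>auto simp: b_edge_def wp_simps tree_of_bool_def listed_edges_iff
        intro!: wp_callI[OF computes_graph_row] wp_callI[OF computes_row_entry] wp_callI[OF inS]\<close>)
qed

text \<open>Only the first summand is traversed, so only \<open>x\<close> needs a bound. One cell of
  the second summand is dropped, which leaves the sum shifted by one instead of two.\<close>

lemma computes_add:
  assumes "at_most_or_inf b x"
  shows "computes (prog T) f_add [tree_of_enat x, tree_of_enat y] (tree_of_enat (x + y)) (20 * (b + 3))"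
proof (cases "x = \<infinity> \<or> y = \<infinity>")
  case True
  then show ?thesis by (intro prog_computesI) (auto simp: b_add_def wp_simps)
next
  case False
  then obtain i j where ij: "x = enat i" "y = enat j" by auto
  then have "i \<le> b" using assms by (simp add: at_most_or_inf_def)
  then show ?thesis
    using computes_app[of T "Suc i" j] unfolding ij
    by (intro prog_computesI)
      (auto simp: b_add_def wp_simps tree_of_enat_enat tree_of_nat_Suc intro!: wp_callI)
qed

lemma computes_min:
  assumes "at_most_or_inf b x"
  shows "computes (prog T) f_min [tree_of_enat x, tree_of_enat y] (tree_of_enat (min x y)) (20 * (b + 3))"
proof (cases "x = \<infinity> \<or> y = \<infinity>")
  case True
  then show ?thesis
    by (intro prog_computesI) (auto simp: b_min_def wp_simps min_def)
next
  case False
  then obtain i j where ij: "x = enat i" "y = enat j" by auto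
  then have "i \<le> b" using assms by (simp add: at_most_or_inf_def)
  then show ?thesis
    unfolding ij
    by (intro prog_computesI)
      (auto simp: b_min_def wp_simps tree_of_enat_enat min_def intro!: wp_callI[OF computes_leq])
qed

section \<open>The distance function\<close>

text \<open>\<open>B\<close> is the time to compute one weight and \<open>b\<close> bounds the
  finite weights. Within the rounds made, finite distances stay below \<open>m * b\<close>, which is
  the origin of the term \<open>m * (20 * b)\<close>.\<close>

definition "loop_cost m b B = B + 40 * (b + 3) + m * (20 * b) + 100"
definition "step_cost m b B = Suc m * (Suc m * loop_cost m b B + 100)"
definition "dist_cost m b B = Suc m * (step_cost m b B + 100) + Suc m * (100 * (m + 1)) + 100 * (m + 2)"

lemma computes_init:
  assumes "v \<le> m"
  shows "set xs \<subseteq> {..m} \<Longrightarrow> computes (prog T) f_init [tree_of_nats xs, tree_of_nat v]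
    (tree_of_list (map (\<lambda>x. tree_of_enat (if x = v then 0 else \<infinity>)) xs)) (Suc (length xs) * (100 * (m + 1)))"
proof (induction xs)
  case Nil
  show ?case by (rule prog_computesI) (auto simp: b_init_def wp_simps)
next
  case (Cons x xs)
  then have "computes (prog T) f_init [tree_of_nats xs, tree_of_nat v]
    (tree_of_list (map (\<lambda>x. tree_of_enat (if x = v then 0 else \<infinity>)) xs)) (Suc (length xs) * (100 * (m + 1)))"
    by simp
  then show ?case
    using Cons.prems assms
    by (intro prog_computesI)
      (auto simp: b_init_def wp_simps intro!: wp_callI[OF computes_eq] elim!: wp_callI)
qed

section \<open>Bellman-Ford for an abstract weight function, used for hop distances and for the
  augmented graph\<close>

context
  fixes T n m b B :: nat and w :: "nat \<Rightarrow> nat \<Rightarrow> enat" and M S G :: tree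
  assumes n_le: "n \<le> m"
    and w: "\<And>x y. x < n \<Longrightarrow> y < n \<Longrightarrow> computes (prog T) f_wt
        [tree_of_nat x, tree_of_nat y, tree_of_nats [0..<n], M, S, G] (tree_of_enat (w x y)) B"
    and b: "\<And>x y. x < n \<Longrightarrow> y < n \<Longrightarrow> at_most_or_inf b (w x y)"
begin

lemma computes_loop:
  assumes "x < n" "\<And>y. y < n \<Longrightarrow> at_most_or_inf (m * b) (d y)"
  shows "set ys \<subseteq> {..<n} \<Longrightarrow> computes (prog T) f_loop
     [tree_of_nats ys, tree_of_list (map (\<lambda>y. tree_of_enat (d y)) ys), tree_of_nat x,
      tree_of_nats [0..<n], M, S, G]
     (tree_of_enat (INF y\<in>set ys. w x y + d y)) (Suc (length ys) * loop_cost m b B)"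
proof (induction ys)
  case Nil
  show ?case
    by (rule prog_computesI) (auto simp: b_loop_def wp_simps loop_cost_def top_enat_def)
next
  case (Cons y ys)
  then have IH: "computes (prog T) f_loop
     [tree_of_nats ys, tree_of_list (map (\<lambda>y. tree_of_enat (d y)) ys), tree_of_nat x,
      tree_of_nats [0..<n], M, S, G]
     (tree_of_enat (INF y\<in>set ys. w x y + d y)) (Suc (length ys) * loop_cost m b B)" and y: "y < n"
    by auto
  have inf: "(INF y\<in>set (y # ys). w x y + d y) = min (w x y + d y) (INF y\<in>set ys. w x y + d y)"
    by (simp add: inf_enat_def)
  have wd: "at_most_or_inf (b + m * b) (w x y + d y)"
    using b assms y by (intro at_most_or_inf_add) auto
  have le: "B + 20 * (b + 3) + 20 * (b + m * b + 3) + 60 \<le> loop_cost m b B"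
    by (simp add: loop_cost_def algebra_simps)
  show ?case
    unfolding inf
    by (rule prog_computesI)
      (use le y assms in \<open>auto simp: b_loop_def wp_simps
        intro!: wp_callI[OF w] wp_callI[OF computes_add[OF b]] wp_callI[OF IH] wp_callI[OF computes_min[OF wd]]\<close>)
qed

lemma computes_step:
  assumes "\<And>y. y < n \<Longrightarrow> at_most_or_inf (m * b) (d y)"
  shows "set xs \<subseteq> {..<n} \<Longrightarrow> computes (prog T) f_step
     [tree_of_nats xs, tree_of_list (map (\<lambda>y. tree_of_enat (d y)) [0..<n]), tree_of_nats [0..<n], M, S, G]
     (tree_of_list (map (\<lambda>x. tree_of_enat (INF y\<in>{..<n}. w x y + d y)) xs))
     (Suc (length xs) * (Suc m * loop_cost m b B + 100))"
proof (induction xs)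
  case Nil
  show ?case by (rule prog_computesI) (auto simp: b_step_def wp_simps)
next
  case (Cons x xs)
  then have IH: "computes (prog T) f_step
     [tree_of_nats xs, tree_of_list (map (\<lambda>y. tree_of_enat (d y)) [0..<n]), tree_of_nats [0..<n], M, S, G]
     (tree_of_list (map (\<lambda>x. tree_of_enat (INF y\<in>{..<n}. w x y + d y)) xs))
     (Suc (length xs) * (Suc m * loop_cost m b B + 100))" and x: "x < n"
    by auto
  have set_upt: "set [0..<n] = {..<n}" by auto
  have loop: "computes (prog T) f_loop
     [tree_of_nats [0..<n], tree_of_list (map (\<lambda>y. tree_of_enat (d y)) [0..<n]), tree_of_nat x,
      tree_of_nats [0..<n], M, S, G]
     (tree_of_enat (INF y\<in>{..<n}. w x y + d y)) (Suc m * loop_cost m b B)"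
    using computes_mono[OF computes_loop[where d = d and ys = "[0..<n]", OF x assms]
        mult_le_mono1[of _ "Suc m"]] n_le
    unfolding set_upt by simp
  show ?case
    by (rule prog_computesI)
      (auto simp: b_step_def wp_simps intro!: wp_callI[OF loop] wp_callI[OF IH])
qed

text \<open>Only the length of \<open>cs\<close> matters: it counts the remaining rounds. The bound
  on \<open>i + length cs\<close> keeps the finite values at most \<open>m * b\<close>.\<close>

lemma computes_iter:
  assumes "v < n"
  shows "i + length cs \<le> n \<Longrightarrow> computes (prog T) f_iter
     [tree_of_list cs, tree_of_list (map (\<lambda>y. tree_of_enat (bellman_ford w n v i y)) [0..<n]),
      tree_of_nats [0..<n], M, S, G]
     (tree_of_list (map (\<lambda>x. tree_of_enat (bellman_ford w n v (i + length cs) x)) [0..<n]))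
     (Suc (length cs) * (step_cost m b B + 100))"
proof (induction cs arbitrary: i)
  case Nil
  show ?case by (rule prog_computesI) (auto simp: b_iter_def wp_simps)
next
  case (Cons c cs)
  have IH: "computes (prog T) f_iter
     [tree_of_list cs, tree_of_list (map (\<lambda>y. tree_of_enat (bellman_ford w n v (Suc i) y)) [0..<n]),
      tree_of_nats [0..<n], M, S, G]
     (tree_of_list (map (\<lambda>x. tree_of_enat (bellman_ford w n v (Suc i + length cs) x)) [0..<n]))
     (Suc (length cs) * (step_cost m b B + 100))"
    using Cons.prems by (intro Cons.IH) simp
  have bf: "at_most_or_inf (m * b) (bellman_ford w n v i y)" if "y < n" for y
  proof -
    have "i * b \<le> m * b" using Cons.prems n_le by (intro mult_le_mono1) simp
    then show ?thesis
      using at_most_or_inf_bellman_ford[where w = w and b = b and v = v and i = i, OF b that]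
      unfolding at_most_or_inf_def by (auto intro: order_trans)
  qed
  have step: "computes (prog T) f_step
     [tree_of_nats [0..<n], tree_of_list (map (\<lambda>y. tree_of_enat (bellman_ford w n v i y)) [0..<n]),
      tree_of_nats [0..<n], M, S, G]
     (tree_of_list (map (\<lambda>x. tree_of_enat (bellman_ford w n v (Suc i) x)) [0..<n])) (step_cost m b B)"
    using computes_mono[OF computes_step[where d = "bellman_ford w n v i" and xs = "[0..<n]", OF bf]
        mult_le_mono1[of _ "Suc m"]] n_le
    unfolding step_cost_def by (simp add: subset_eq)
  show ?case
    by (rule prog_computesI)
      (auto simp: b_iter_def wp_simps simp del: bellman_ford.simps
        intro!: wp_callI[OF step] wp_callI[OF IH])
qed

lemma computes_dist_bellman_ford:
  assumes "x < n" "v < n"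
  shows "computes (prog T) f_dist
    [tree_of_nat x, tree_of_nat v, tree_of_nats [0..<n], M, S, G]
    (tree_of_enat (bellman_ford w n v n x)) (dist_cost m b B)"
proof -
  have init: "computes (prog T) f_init [tree_of_nats [0..<n], tree_of_nat v]
    (tree_of_list (map (\<lambda>x. tree_of_enat (bellman_ford w n v 0 x)) [0..<n])) (Suc m * (100 * (m + 1)))"
    using computes_mono[OF computes_init[where xs = "[0..<n]" and v = v and m = m and T = T]
        mult_le_mono1[of _ "Suc m"]] assms n_le
    by (simp add: subset_eq)
  have iter: "computes (prog T) f_iter
     [tree_of_nats [0..<n], tree_of_list (map (\<lambda>y. tree_of_enat (bellman_ford w n v 0 y)) [0..<n]),
      tree_of_nats [0..<n], M, S, G]
     (tree_of_list (map (\<lambda>x. tree_of_enat (bellman_ford w n v n x)) [0..<n]))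
     (Suc m * (step_cost m b B + 100))"
    using computes_mono[OF computes_iter[where i = 0 and cs = "map tree_of_nat [0..<n]", OF assms(2)]
        mult_le_mono1[of _ "Suc m"]] n_le
    by (simp del: bellman_ford.simps)
  have nth: "computes (prog T) f_nth
     [tree_of_list (map (\<lambda>x. tree_of_enat (bellman_ford w n v n x)) [0..<n]), tree_of_nat x]
     (tree_of_enat (bellman_ford w n v n x)) (20 * (x + 1))"
    using computes_nth[of x "map (\<lambda>x. tree_of_enat (bellman_ford w n v n x)) [0..<n]" T] assms(1) by simp
  show ?thesis
    by (rule prog_computesI)
      (use assms n_le in \<open>auto simp: b_dist_def wp_simps dist_cost_def simp del: bellman_ford.simps
        intro!: wp_callI[OF init] wp_callI[OF iter] wp_callI[OF nth]\<close>)
qed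

end

section \<open>The search\<close>

definition "hop_wt_cost m = 20 * (2 * m + 3) + edge_cost m + 50"
definition "hop_cost m = dist_cost m 1 (hop_wt_cost m)"
definition "wt_cost m = hop_wt_cost m + hop_cost m + 50"
text \<open>The finite weights are hop distances in \<Gamma> and hence at most \<open>m\<close>,
  which explains the second argument; for hop distances themselves it is 1.\<close>

definition "wd_cost m = dist_cost m m (wt_cost m)"
definition "row_cost m = 40 * (m + 1) + wd_cost m + 20 * (m * m + 3) + 100"
definition "ok_cost m = Suc m * (Suc m * row_cost m + 100)"
definition "near_cost m = Suc m * (hop_cost m + 20 * (m + 3) + 100)"

lemma listed_edges_Nil [simp]: "listed_edges [] = {}"
  by (simp add: listed_edges_def)

lemma listed_pairs_subset: "(a, b) \<in> listed_pairs S \<Longrightarrow> a \<in> set S \<and> b \<in> set S"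
  by (induction S rule: listed_pairs.induct) auto

lemma listed_edges_Pow: "set S \<subseteq> A \<Longrightarrow> listed_edges S \<subseteq> Pow A"
  unfolding listed_edges_def by (auto dest: listed_pairs_subset)

lemma at_most_or_inf_mono: "at_most_or_inf a x \<Longrightarrow> a \<le> b \<Longrightarrow> at_most_or_inf b x"
  unfolding at_most_or_inf_def by (auto intro: order_trans)

lemma at_most_or_inf_wd:
  assumes "x < n" "E \<subseteq> Pow {..<n}" "\<And>x y. x < n \<Longrightarrow> y < n \<Longrightarrow> at_most_or_inf b (w x y)"
  shows "at_most_or_inf (n * b) (weighted_dist w E x v)"
  unfolding bellman_ford_eq_wd[OF assms(1,2), symmetric]
  by (rule at_most_or_inf_bellman_ford) (use assms in \<open>auto simp: pair_weight_def at_most_or_inf_def\<close>)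

lemma at_most_or_inf_hop_dist:
  "x < n \<Longrightarrow> F \<subseteq> Pow {..<n} \<Longrightarrow> at_most_or_inf n (hop_dist F x v)"
  unfolding hop_dist_def using at_most_or_inf_wd[of x n F 1 "\<lambda>_ _. 1" v]
  by (simp add: at_most_or_inf_def one_enat_def)

text \<open>\<open>f_leq\<close> walks along its first argument, so the time depends on the distance
  and not on the threshold \<open>r\<close>. This keeps the costs independent of \<open>T\<close>,
  even if \<open>T\<close> is far larger than \<open>n\<close>.\<close>

lemma computes_within:
  assumes "at_most_or_inf b d"
  shows "computes (prog T) f_within [tree_of_enat d, tree_of_nat r] (tree_of_bool (d \<le> enat r)) (20 * (b + 3))"
proof (cases d)
  case (enat i)
  then have "i \<le> b" using assms by (simp add: at_most_or_inf_def)
  then show ?thesis unfolding enat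
    by (intro prog_computesI)
      (auto simp: b_within_def wp_simps tree_of_enat_enat tree_of_nat_Suc intro!: wp_callI[OF computes_leq])
qed (rule prog_computesI; auto simp: b_within_def wp_simps tree_of_bool_def)

lemma computes_verts:
  "computes (prog T) f_verts [tree_of_list rows, tree_of_nat i] (tree_of_nats [i..<i + length rows])
     (20 * (length rows + 1))"
proof (induction rows arbitrary: i)
  case Nil
  show ?case by (rule prog_computesI) (auto simp: b_verts_def wp_simps)
next
  case (Cons r rows)
  have upt: "[i..<i + length (r # rows)] = i # [Suc i..<Suc i + length rows]"
    using upt_conv_Cons[of i "i + length (r # rows)"] by (simp del: upt_Suc)
  show ?case unfolding upt
    by (rule prog_computesI)
      (auto simp: b_verts_def wp_simps tree_of_nat_Suc[symmetric] simp del: upt_Suc intro!: wp_callI[OF Cons.IH])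
qed

primrec greedy_centers :: "(nat \<Rightarrow> bool) \<Rightarrow> (nat \<Rightarrow> nat \<Rightarrow> bool) \<Rightarrow> nat list \<Rightarrow> nat list \<Rightarrow> nat list"
where
  "greedy_centers ok near [] C = C"
| "greedy_centers ok near (x # xs) C =
     greedy_centers ok near xs (if ok x \<or> (\<exists>c\<in>set C. near c x) then C else x # C)"

definition augments :: "nat \<Rightarrow> nat \<Rightarrow> nat set set \<Rightarrow> nat set set \<Rightarrow> nat list \<Rightarrow> bool" where
  "augments T n E \<Gamma> S \<longleftrightarrow>
     (\<forall>u<n. \<forall>v<n. {u, v} \<in> \<Gamma> \<longrightarrow> weighted_dist (hop_dist \<Gamma>) (E \<union> listed_edges S) u v \<le> enat T)"

definition "search_result T n E \<Gamma> K c S \<longleftrightarrow>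
  (\<exists>xs. length xs \<le> c \<and> set xs \<subseteq> set K \<and> augments T n E \<Gamma> (xs @ S))"

lemma search_result_0: "search_result T n E \<Gamma> K 0 S \<longleftrightarrow> augments T n E \<Gamma> S"
  by (simp add: search_result_def)

text \<open>The search puts new vertices in front of \<open>S\<close>, so the vertex chosen first is
  the last one of \<open>xs\<close>; therefore \<open>xs\<close> is split at its end.\<close>

lemma search_result_Suc:
  "search_result T n E \<Gamma> K (Suc c) S \<longleftrightarrow> augments T n E \<Gamma> S \<or> (\<exists>a\<in>set K. search_result T n E \<Gamma> K c (a # S))"
proof
  assume "search_result T n E \<Gamma> K (Suc c) S"
  then obtain xs where xs: "length xs \<le> Suc c" "set xs \<subseteq> set K" "augments T n E \<Gamma> (xs @ S)"
    unfolding search_result_def by blast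
  then show "augments T n E \<Gamma> S \<or> (\<exists>a\<in>set K. search_result T n E \<Gamma> K c (a # S))"
    by (cases xs rule: rev_cases) (auto simp: search_result_def)
next
  assume "augments T n E \<Gamma> S \<or> (\<exists>a\<in>set K. search_result T n E \<Gamma> K c (a # S))"
  then show "search_result T n E \<Gamma> K (Suc c) S"
  proof
    assume "\<exists>a\<in>set K. search_result T n E \<Gamma> K c (a # S)"
    then obtain a xs where "a \<in> set K" "length xs \<le> c" "set xs \<subseteq> set K" "augments T n E \<Gamma> (xs @ a # S)"
      unfolding search_result_def by blast
    then show ?thesis unfolding search_result_def by (intro exI[of _ "xs @ [a]"]) auto
  qed (auto simp: search_result_def intro: exI[of _ "[]"])
qed

text \<open>A closed form for the recursion in \<open>search_cost_Suc\<close>: each of the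
  \<open>c + 1\<close> levels is charged the final number of leaves. The base is
  \<open>N + 1\<close> because \<open>f_try\<close> also makes a call for the end of its
  list.\<close>

definition "search_cost m N c = (ok_cost m + 200) * (c + 1) * (N + 1) ^ c"

lemma search_cost_Suc: "ok_cost m + 100 + Suc N * (search_cost m N c + 100) \<le> search_cost m N (Suc c)"
proof -
  let ?A = "ok_cost m + 200" and ?p = "Suc N ^ Suc c"
  have "search_cost m N (Suc c) = ?A * (c + 1) * ?p + ?A * ?p"
    unfolding search_cost_def by (simp add: algebra_simps)
  moreover have "Suc N * search_cost m N c = ?A * (c + 1) * ?p"
    unfolding search_cost_def by (simp add: algebra_simps)
  moreover have "ok_cost m + 100 + Suc N * 100 \<le> ?A * Suc N" by simp
  moreover have "?A * Suc N \<le> ?A * ?p"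
    using power_increasing[of 1 "Suc c" "Suc N"] by (intro mult_le_mono2) (simp only: power_one_right)
  ultimately show ?thesis unfolding distrib_left by linarith
qed

context
  fixes T n m :: nat
  assumes n_le: "n \<le> m"
begin

lemma computes_hop_dist:
  assumes "F \<subseteq> Pow {..<n}" "x < n" "y < n"
  shows "computes (prog T) f_dist
      [tree_of_nat x, tree_of_nat y, tree_of_nats [0..<n], tree_of_graph n F, Leaf, Leaf]
      (tree_of_enat (hop_dist F x y)) (hop_cost m)"
proof -
  have wt: "computes (prog T) f_wt
      [tree_of_nat x, tree_of_nat y, tree_of_nats [0..<n], tree_of_graph n F, Leaf, Leaf]
      (tree_of_enat (pair_weight (\<lambda>_ _. 1) F x y)) (hop_wt_cost m)" if "x < n" "y < n" for x y
    using computes_edge[of "[]" n m x y T F] n_le that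
    by (intro prog_computesI)
      (auto simp: b_wt_def wp_simps pair_weight_def hop_wt_cost_def
        intro!: wp_callI[OF computes_eq] elim!: wp_callI)
  have b: "at_most_or_inf 1 (pair_weight (\<lambda>_ _. 1) F x y)" for x y
    by (simp add: pair_weight_def at_most_or_inf_def one_enat_def)
  show ?thesis
    using computes_dist_bellman_ford[OF n_le wt b assms(2,3)]
    unfolding hop_dist_def hop_cost_def bellman_ford_eq_wd[OF assms(2,1)] .
qed

context
  fixes E \<Gamma> :: "nat set set"
  assumes n_pos: "0 < n" and E: "E \<subseteq> Pow {..<n}" and \<Gamma>: "\<Gamma> \<subseteq> Pow {..<n}"
begin

abbreviation "aug_dist S \<equiv> weighted_dist (hop_dist \<Gamma>) (E \<union> listed_edges S)"

lemma computes_aug_dist: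
  assumes "set S \<subseteq> {..<n}" "length S \<le> m" "x < n" "y < n"
  shows "computes (prog T) f_dist
      [tree_of_nat x, tree_of_nat y, tree_of_nats [0..<n], tree_of_graph n E, tree_of_nats S, tree_of_graph n \<Gamma>]
      (tree_of_enat (aug_dist S x y)) (wd_cost m)"
proof -
  have ES: "E \<union> listed_edges S \<subseteq> Pow {..<n}" using E listed_edges_Pow[OF assms(1)] by blast
  \<comment> \<open>For \<open>n = 0\<close> the matrix would be a leaf and would select unit
    weights.\<close>
  have \<Gamma>_Leaf: "tree_of_graph n \<Gamma> \<noteq> Leaf" using n_pos by (simp add: tree_of_graph_def)
  have wt: "computes (prog T) f_wt
      [tree_of_nat x, tree_of_nat y, tree_of_nats [0..<n], tree_of_graph n E, tree_of_nats S, tree_of_graph n \<Gamma>]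
      (tree_of_enat (pair_weight (hop_dist \<Gamma>) (E \<union> listed_edges S) x y)) (wt_cost m)" if "x < n" "y < n" for x y
    using \<Gamma>_Leaf that n_le
    by (intro prog_computesI)
      (auto simp: b_wt_def wp_simps pair_weight_def wt_cost_def hop_wt_cost_def
        intro!: wp_callI[OF computes_eq] wp_callI[OF computes_edge[OF assms(1,2) n_le that]]
          wp_callI[OF computes_hop_dist[OF \<Gamma> that]])
  have b: "at_most_or_inf m (pair_weight (hop_dist \<Gamma>) (E \<union> listed_edges S) x y)" if "x < n" "y < n" for x y
    using at_most_or_inf_mono[OF at_most_or_inf_hop_dist[OF that(1) \<Gamma>] n_le]
    by (auto simp: pair_weight_def at_most_or_inf_def)
  show ?thesis
    using computes_dist_bellman_ford[OF n_le wt b assms(3,4)]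
    unfolding wd_cost_def bellman_ford_eq_wd[OF assms(3) ES] .
qed

lemma at_most_or_inf_aug_dist:
  assumes "set S \<subseteq> {..<n}" "x < n"
  shows "at_most_or_inf (m * m) (aug_dist S x y)"
proof (rule at_most_or_inf_mono)
  show "at_most_or_inf (n * n) (aug_dist S x y)"
    using assms E listed_edges_Pow[OF assms(1)]
    by (intro at_most_or_inf_wd) (auto intro: at_most_or_inf_hop_dist[OF _ \<Gamma>])
qed (simp add: n_le mult_le_mono)

lemma computes_row_ok:
  assumes "set S \<subseteq> {..<n}" "length S \<le> m" "u < n"
  shows "set R \<subseteq> {..<n} \<Longrightarrow> computes (prog T) f_row_ok
      [tree_of_nats R, tree_of_nat u, tree_of_nats [0..<n], tree_of_graph n E, tree_of_nats S, tree_of_graph n \<Gamma>]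
      (tree_of_bool (\<forall>v\<in>set R. {u, v} \<in> \<Gamma> \<longrightarrow> aug_dist S u v \<le> enat T)) (Suc (length R) * row_cost m)"
proof (induction R)
  case Nil
  show ?case by (rule prog_computesI) (auto simp: b_row_ok_def wp_simps row_cost_def tree_of_bool_def)
next
  case (Cons v R)
  then have IH: "computes (prog T) f_row_ok
      [tree_of_nats R, tree_of_nat u, tree_of_nats [0..<n], tree_of_graph n E, tree_of_nats S, tree_of_graph n \<Gamma>]
      (tree_of_bool (\<forall>v\<in>set R. {u, v} \<in> \<Gamma> \<longrightarrow> aug_dist S u v \<le> enat T)) (Suc (length R) * row_cost m)"
    and v: "v < n" by auto
  have le: "20 * (u + 1) + 20 * (v + 1) + wd_cost m + 20 * (m * m + 3) + 60 \<le> row_cost m"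
    using v assms(3) n_le by (simp add: row_cost_def)
  \<comment> \<open>The propositions are made opaque, so that the simplifier only splits on their
    truth values and leaves the distances alone.\<close>
  define p q where "p \<longleftrightarrow> aug_dist S u v \<le> enat T"
    and "q \<longleftrightarrow> (\<forall>v\<in>set R. {u, v} \<in> \<Gamma> \<longrightarrow> aug_dist S u v \<le> enat T)"
  note within = computes_within[OF at_most_or_inf_aug_dist[OF assms(1,3)], of T v T, folded p_def]
  show ?case
    unfolding list.set ball_simps p_def[symmetric] q_def[symmetric]
    by (rule prog_computesI)
      (use le v assms(3) in \<open>auto simp: b_row_ok_def wp_simps tree_of_bool_def
        intro!: wp_callI[OF computes_graph_row] wp_callI[OF computes_row_entry]
          wp_callI[OF computes_aug_dist[OF assms v]] wp_callI[OF within] wp_callI[OF IH[folded q_def]]\<close>)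
qed

lemma computes_row_ok_all:
  assumes "set S \<subseteq> {..<n}" "length S \<le> m" "u < n"
  shows "computes (prog T) f_row_ok
      [tree_of_nats [0..<n], tree_of_nat u, tree_of_nats [0..<n], tree_of_graph n E, tree_of_nats S,
       tree_of_graph n \<Gamma>]
      (tree_of_bool (\<forall>v<n. {u, v} \<in> \<Gamma> \<longrightarrow> aug_dist S u v \<le> enat T)) (Suc m * row_cost m)"
proof -
  have eq: "(\<forall>v\<in>set [0..<n]. P v) \<longleftrightarrow> (\<forall>v<n. P v)" for P by auto
  show ?thesis
    using computes_mono[OF computes_row_ok[OF assms, of "[0..<n]"] mult_le_mono1[of _ "Suc m"]] n_le
    unfolding eq by (simp add: subset_eq)
qed

lemma computes_ok_list:
  assumes "set S \<subseteq> {..<n}" "length S \<le> m"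
  shows "set R \<subseteq> {..<n} \<Longrightarrow> computes (prog T) f_ok
      [tree_of_nats R, tree_of_nats [0..<n], tree_of_graph n E, tree_of_nats S, tree_of_graph n \<Gamma>]
      (tree_of_bool (\<forall>u\<in>set R. \<forall>v<n. {u, v} \<in> \<Gamma> \<longrightarrow> aug_dist S u v \<le> enat T))
      (Suc (length R) * (Suc m * row_cost m + 100))"
proof (induction R)
  case Nil
  show ?case by (rule prog_computesI) (auto simp: b_ok_def wp_simps tree_of_bool_def)
next
  case (Cons u R)
  then have IH: "computes (prog T) f_ok
      [tree_of_nats R, tree_of_nats [0..<n], tree_of_graph n E, tree_of_nats S, tree_of_graph n \<Gamma>]
      (tree_of_bool (\<forall>u\<in>set R. \<forall>v<n. {u, v} \<in> \<Gamma> \<longrightarrow> aug_dist S u v \<le> enat T))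
      (Suc (length R) * (Suc m * row_cost m + 100))" and u: "u < n"
    by auto
  define p q where "p \<longleftrightarrow> (\<forall>v<n. {u, v} \<in> \<Gamma> \<longrightarrow> aug_dist S u v \<le> enat T)"
    and "q \<longleftrightarrow> (\<forall>u\<in>set R. \<forall>v<n. {u, v} \<in> \<Gamma> \<longrightarrow> aug_dist S u v \<le> enat T)"
  note row = computes_row_ok_all[OF assms u, folded p_def]
  show ?case
    unfolding list.set ball_simps p_def[symmetric] q_def[symmetric]
    by (rule prog_computesI)
      (auto simp: b_ok_def wp_simps tree_of_bool_def
        intro!: wp_callI[OF row] wp_callI[OF IH[folded q_def]])
qed

lemma computes_ok:
  assumes "set S \<subseteq> {..<n}" "length S \<le> m"
  shows "computes (prog T) f_ok
      [tree_of_nats [0..<n], tree_of_nats [0..<n], tree_of_graph n E, tree_of_nats S, tree_of_graph n \<Gamma>]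
      (tree_of_bool (augments T n E \<Gamma> S)) (ok_cost m)"
proof -
  have eq: "(\<forall>v\<in>set [0..<n]. P v) \<longleftrightarrow> (\<forall>v<n. P v)" for P by auto
  show ?thesis
    using computes_mono[OF computes_ok_list[OF assms, of "[0..<n]"] mult_le_mono1[of _ "Suc m"]] n_le
    unfolding eq augments_def ok_cost_def by (simp add: subset_eq)
qed

lemma computes_near_list:
  assumes "v < n"
  shows "set C \<subseteq> {..<n} \<Longrightarrow> computes (prog T) f_near
      [tree_of_nats C, tree_of_nat v, tree_of_nat r, tree_of_nats [0..<n], tree_of_graph n E]
      (tree_of_bool (\<exists>c\<in>set C. hop_dist E c v \<le> enat r))
      (Suc (length C) * (hop_cost m + 20 * (m + 3) + 100))"
proof (induction C)
  case Nil
  show ?case by (rule prog_computesI) (auto simp: b_near_def wp_simps tree_of_bool_def)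
next
  case (Cons c C)
  then have IH: "computes (prog T) f_near
      [tree_of_nats C, tree_of_nat v, tree_of_nat r, tree_of_nats [0..<n], tree_of_graph n E]
      (tree_of_bool (\<exists>c\<in>set C. hop_dist E c v \<le> enat r))
      (Suc (length C) * (hop_cost m + 20 * (m + 3) + 100))" and c: "c < n"
    by auto
  have *: "at_most_or_inf m (hop_dist E c v)"
    using at_most_or_inf_mono[OF at_most_or_inf_hop_dist[OF c E] n_le] .
  define p q where "p \<longleftrightarrow> hop_dist E c v \<le> enat r" and "q \<longleftrightarrow> (\<exists>c\<in>set C. hop_dist E c v \<le> enat r)"
  note within = computes_within[OF *, of T r, folded p_def]
  show ?case
    unfolding list.set bex_simps p_def[symmetric] q_def[symmetric]
    by (rule prog_computesI)
      (auto simp: b_near_def wp_simps tree_of_bool_def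
        intro!: wp_callI[OF computes_hop_dist[OF E c assms]] wp_callI[OF within] wp_callI[OF IH[folded q_def]])
qed

lemma computes_near:
  assumes "v < n" "set C \<subseteq> {..<n}" "length C \<le> m"
  shows "computes (prog T) f_near
      [tree_of_nats C, tree_of_nat v, tree_of_nat r, tree_of_nats [0..<n], tree_of_graph n E]
      (tree_of_bool (\<exists>c\<in>set C. hop_dist E c v \<le> enat r)) (near_cost m)"
  unfolding near_cost_def
  by (rule computes_mono[OF computes_near_list[OF assms(1,2)]]) (use assms(3) in \<open>intro mult_le_mono1, simp\<close>)

abbreviation "centers \<equiv> greedy_centers
  (\<lambda>u. \<forall>v<n. {u, v} \<in> \<Gamma> \<longrightarrow> aug_dist [] u v \<le> enat T) (\<lambda>c v. hop_dist E c v \<le> enat (2 * T))"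

text \<open>Each scanned vertex adds at most one center, so the sum of the two lengths never grows
  and every nearness test stays within \<open>near_cost m\<close>. The limit 2k is checked only
  afterwards.\<close>

lemma computes_greedy:
  "\<lbrakk>set R \<subseteq> {..<n}; set C \<subseteq> {..<n}; length R + length C \<le> m\<rbrakk> \<Longrightarrow> computes (prog T) f_greedy
      [tree_of_nats R, tree_of_nats C, tree_of_nats [0..<n], tree_of_graph n E, tree_of_graph n \<Gamma>]
      (tree_of_nats (centers R C)) (Suc (length R) * (Suc m * row_cost m + near_cost m + 100))"
proof (induction R arbitrary: C)
  case Nil
  show ?case by (rule prog_computesI) (auto simp: b_greedy_def wp_simps)
next
  case (Cons u R)
  define C' where "C' = (if (\<forall>v<n. {u, v} \<in> \<Gamma> \<longrightarrow> aug_dist [] u v \<le> enat T) \<or>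
    (\<exists>c\<in>set C. hop_dist E c u \<le> enat (2 * T)) then C else u # C)"
  have IH: "computes (prog T) f_greedy
      [tree_of_nats R, tree_of_nats C', tree_of_nats [0..<n], tree_of_graph n E, tree_of_graph n \<Gamma>]
      (tree_of_nats (centers R C')) (Suc (length R) * (Suc m * row_cost m + near_cost m + 100))"
    using Cons.prems by (intro Cons.IH) (auto simp: C'_def)
  have u: "u < n" and C: "set C \<subseteq> {..<n}" "length C \<le> m" using Cons.prems by auto
  have row: "computes (prog T) f_row_ok
      [tree_of_nats [0..<n], tree_of_nat u, tree_of_nats [0..<n], tree_of_graph n E, Leaf, tree_of_graph n \<Gamma>]
      (tree_of_bool (\<forall>v<n. {u, v} \<in> \<Gamma> \<longrightarrow> aug_dist [] u v \<le> enat T)) (Suc m * row_cost m)"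
    using computes_row_ok_all[of "[]" u] u by simp
  have eq: "centers (u # R) C = centers R C'" by (simp add: C'_def)
  define p q where "p \<longleftrightarrow> (\<forall>v<n. {u, v} \<in> \<Gamma> \<longrightarrow> aug_dist [] u v \<le> enat T)"
    and "q \<longleftrightarrow> (\<exists>c\<in>set C. hop_dist E c u \<le> enat (2 * T))"
  have C': "C' = (if p \<or> q then C else u # C)" unfolding C'_def p_def q_def ..
  note near = computes_near[OF u C, of "2 * T", folded q_def]
  have tree_C': "tree_of_nats C' = (if p \<or> q then tree_of_nats C else Node (tree_of_nat u) (tree_of_nats C))"
    unfolding C' by simp
  note IH' = IH[unfolded tree_C']
  show ?case
    unfolding eq
    by (rule prog_computesI, cases p; cases q)
      (use IH' in \<open>auto simp: b_greedy_def wp_simps intro!: wp_callI[OF row[folded p_def]] wp_callI[OF near]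
        elim!: wp_callI\<close>)
qed

lemma computes_cands:
  assumes "set C \<subseteq> {..<n}" "length C \<le> m"
  shows "set R \<subseteq> {..<n} \<Longrightarrow> computes (prog T) f_cands
      [tree_of_nats R, tree_of_nats C, tree_of_nats [0..<n], tree_of_graph n E]
      (tree_of_nats (filter (\<lambda>v. \<exists>c\<in>set C. hop_dist E c v \<le> enat (T * T + 2 * T)) R))
      (Suc (length R) * (near_cost m + 100))"
proof (induction R)
  case Nil
  show ?case by (rule prog_computesI) (auto simp: b_cands_def wp_simps)
next
  case (Cons v R)
  let ?f = "\<lambda>v. \<exists>c\<in>set C. hop_dist E c v \<le> enat (T * T + 2 * T)"
  from Cons have IH: "computes (prog T) f_cands
      [tree_of_nats R, tree_of_nats C, tree_of_nats [0..<n], tree_of_graph n E]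
      (tree_of_nats (filter ?f R)) (Suc (length R) * (near_cost m + 100))" and v: "v < n"
    by auto
  define b where "b = ?f v"
  have near: "computes (prog T) f_near
      [tree_of_nats C, tree_of_nat v, tree_of_nat (T * T + 2 * T), tree_of_nats [0..<n], tree_of_graph n E]
      (tree_of_bool b) (near_cost m)"
    using computes_near[OF v assms, of "T * T + 2 * T"] unfolding b_def .
  have "filter ?f (v # R) = (if b then v # filter ?f R else filter ?f R)" unfolding b_def by simp
  then show ?case
    by (simp only:, intro prog_computesI)
      (auto simp: b_cands_def wp_simps intro!: wp_callI[OF near] wp_callI[OF IH])
qed

text \<open>\<open>f_search\<close> and \<open>f_try\<close> call each other. Correctness of the
  search for \<open>c\<close> is assumed here, to be supplied by the induction on \<open>c\<close>
  in \<open>computes_search\<close>.\<close>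

lemma computes_try:
  assumes search: "\<And>a. a \<in> set K \<Longrightarrow> computes (prog T) f_search
      [tree_of_nat c, tree_of_nats (a # S), tree_of_nats K, tree_of_nats [0..<n], tree_of_graph n E, tree_of_graph n \<Gamma>]
      (tree_of_bool (search_result T n E \<Gamma> K c (a # S))) (search_cost m (length K) c)"
  shows "set R \<subseteq> set K \<Longrightarrow> computes (prog T) f_try
      [tree_of_nats R, tree_of_nat (Suc c), tree_of_nats S, tree_of_nats K, tree_of_nats [0..<n],
       tree_of_graph n E, tree_of_graph n \<Gamma>]
      (tree_of_bool (\<exists>a\<in>set R. search_result T n E \<Gamma> K c (a # S))) (Suc (length R) * (search_cost m (length K) c + 100))"
proof (induction R)
  case Nil
  show ?case by (rule prog_computesI) (auto simp: b_try_def wp_simps tree_of_bool_def)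
next
  case (Cons a R)
  then have IH: "computes (prog T) f_try
      [tree_of_nats R, Node Leaf (tree_of_nat c), tree_of_nats S, tree_of_nats K, tree_of_nats [0..<n],
       tree_of_graph n E, tree_of_graph n \<Gamma>]
      (tree_of_bool (\<exists>a\<in>set R. search_result T n E \<Gamma> K c (a # S))) (Suc (length R) * (search_cost m (length K) c + 100))"
    by (simp add: tree_of_nat_Suc)
  have s: "computes (prog T) f_search
      [tree_of_nat c, Node (tree_of_nat a) (tree_of_nats S), tree_of_nats K, tree_of_nats [0..<n],
       tree_of_graph n E, tree_of_graph n \<Gamma>]
      (tree_of_bool (search_result T n E \<Gamma> K c (a # S))) (search_cost m (length K) c)"
    using search[of a] Cons.prems by simp
  define q where "q \<longleftrightarrow> (\<exists>a\<in>set R. search_result T n E \<Gamma> K c (a # S))"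
  show ?case
    unfolding list.set bex_simps q_def[symmetric]
    by (rule prog_computesI)
      (auto simp: b_try_def wp_simps tree_of_bool_def tree_of_nat_Suc intro!: wp_callI[OF s] wp_callI[OF IH[folded q_def]])
qed

lemma computes_search:
  assumes "set K \<subseteq> {..<n}"
  shows "\<lbrakk>set S \<subseteq> {..<n}; length S + c \<le> m\<rbrakk> \<Longrightarrow> computes (prog T) f_search
      [tree_of_nat c, tree_of_nats S, tree_of_nats K, tree_of_nats [0..<n], tree_of_graph n E, tree_of_graph n \<Gamma>]
      (tree_of_bool (search_result T n E \<Gamma> K c S)) (search_cost m (length K) c)"
proof (induction c arbitrary: S)
  case 0
  then have ok: "computes (prog T) f_ok
      [tree_of_nats [0..<n], tree_of_nats [0..<n], tree_of_graph n E, tree_of_nats S, tree_of_graph n \<Gamma>]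
      (tree_of_bool (search_result T n E \<Gamma> K 0 S)) (ok_cost m)"
    unfolding search_result_0 by (intro computes_ok) auto
  show ?case
    by (rule prog_computesI)
      (auto simp: b_search_def wp_simps tree_of_bool_def search_cost_def intro!: wp_callI[OF ok])
next
  case (Suc c)
  have ok: "computes (prog T) f_ok
      [tree_of_nats [0..<n], tree_of_nats [0..<n], tree_of_graph n E, tree_of_nats S, tree_of_graph n \<Gamma>]
      (tree_of_bool (augments T n E \<Gamma> S)) (ok_cost m)"
    using Suc.prems by (intro computes_ok) auto
  have try': "computes (prog T) f_try
      [tree_of_nats K, tree_of_nat (Suc c), tree_of_nats S, tree_of_nats K, tree_of_nats [0..<n],
       tree_of_graph n E, tree_of_graph n \<Gamma>]
      (tree_of_bool (\<exists>a\<in>set K. search_result T n E \<Gamma> K c (a # S))) (Suc (length K) * (search_cost m (length K) c + 100))"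
    by (rule computes_try[OF _ order_refl], rule Suc.IH) (use Suc.prems assms in auto)
  define q where "q \<longleftrightarrow> (\<exists>a\<in>set K. search_result T n E \<Gamma> K c (a # S))"
  show ?case
    unfolding search_result_Suc q_def[symmetric]
    by (rule prog_computesI)
      (use search_cost_Suc[of m "length K" c] in \<open>auto simp: b_search_def wp_simps tree_of_bool_def
        intro!: wp_callI[OF ok] wp_callI[OF try'[folded q_def]]\<close>)
qed

end

end

section \<open>Correctness\<close>

lemma set_greedy_centers: "set (greedy_centers ok near R C) \<subseteq> set C \<union> {x \<in> set R. \<not> ok x}"
proof (induction R arbitrary: C)
  case (Cons x R)
  show ?case
    using Cons.IH[of C] Cons.IH[of "x # C"] by auto
qed auto

lemma set_greedy_centers_mono: "set C \<subseteq> set (greedy_centers ok near R C)"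
proof (induction R arbitrary: C)
  case (Cons x R)
  show ?case using Cons.IH[of C] Cons.IH[of "x # C"] by auto
qed auto

lemma length_greedy_centers: "length (greedy_centers ok near R C) \<le> length R + length C"
proof (induction R arbitrary: C)
  case (Cons x R)
  show ?case using Cons.IH[of C] Cons.IH[of "x # C"] by auto
qed auto

text \<open>New centers are put in front, so no entry is near one behind it. Symmetry of the hop
  distance will turn this into pairwise separation.\<close>

lemma sorted_wrt_greedy_centers:
  "sorted_wrt (\<lambda>x c. \<not> near c x) C \<Longrightarrow> sorted_wrt (\<lambda>x c. \<not> near c x) (greedy_centers ok near R C)"
  by (induction R arbitrary: C) auto

text \<open>A vertex that is passed over was near a center already chosen, and centers are never
  removed; a chosen vertex is near itself.\<close>

lemma greedy_centers_cover:
  assumes "\<And>x. near x x" "x \<in> set R" "\<not> ok x"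
  shows "\<exists>c \<in> set (greedy_centers ok near R C). near c x"
  using assms(2)
proof (induction R arbitrary: C)
  case (Cons y R)
  show ?case
  proof (cases "x = y")
    case True
    then show ?thesis
      using assms(1,3) set_greedy_centers_mono[of C ok near R] set_greedy_centers_mono[of "y # C" ok near R]
      by auto
  qed (use Cons in simp)
qed simp

definition "main_cost m =
  20 * (m + 1) + Suc m * (Suc m * row_cost m + near_cost m + 100) + 40 * (m + 1) +
  Suc m * (near_cost m + 100) + 300"

definition candidates :: "nat \<Rightarrow> nat \<Rightarrow> nat set set \<Rightarrow> nat list \<Rightarrow> nat list" where
  "candidates T n E C = filter (\<lambda>v. \<exists>c\<in>set C. hop_dist E c v \<le> enat (T * T + 2 * T)) [0..<n]"

text \<open>The search is charged only if it is run: with more than 2k centers the number of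
  candidates has no bound in terms of k.\<close>

lemma computes_main:
  fixes T :: nat
  assumes n: "0 < n" "n \<le> m" and k: "2 * k \<le> m"
    and E: "E \<subseteq> Pow {..<n}" and \<Gamma>: "\<Gamma> \<subseteq> Pow {..<n}"
    and C: "C = centers T n E \<Gamma> [0..<n] []"
  shows "computes (prog T) f_main [tree_of_graph n E, tree_of_graph n \<Gamma>, tree_of_nat k]
    (tree_of_bool (length C \<le> 2 * k \<and> search_result T n E \<Gamma> (candidates T n E C) (2 * k) []))
    (main_cost m + (if length C \<le> 2 * k then search_cost m (length (candidates T n E C)) (2 * k) else 0))"
proof -
  have set_C: "set C \<subseteq> {..<n}"
    using set_greedy_centers[of _ _ "[0..<n]" "[]"] unfolding C by fastforce
  have len_C: "length C \<le> m"
    using length_greedy_centers[of _ _ "[0..<n]" "[]"] n(2) unfolding C by (auto intro: order_trans)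
  have verts: "computes (prog T) f_verts [tree_of_graph n E, Leaf] (tree_of_nats [0..<n]) (20 * (m + 1))"
    unfolding tree_of_graph_def
    using computes_mono[OF computes_verts[of T "map (\<lambda>u. tree_of_list (map (\<lambda>v. tree_of_bool ({u, v} \<in> E)) [0..<n])) [0..<n]" 0]] n(2)
    by simp
  have greedy: "computes (prog T) f_greedy
      [tree_of_nats [0..<n], Leaf, tree_of_nats [0..<n], tree_of_graph n E, tree_of_graph n \<Gamma>]
      (tree_of_nats C) (Suc m * (Suc m * row_cost m + near_cost m + 100))"
    using computes_mono[OF computes_greedy[OF n(2,1) E \<Gamma>, where R = "[0..<n]" and C = "[]" and T = T]
        mult_le_mono1[of _ "Suc m"]] n(2)
    unfolding C by (simp add: subset_eq)
  have app: "computes (prog T) f_app [tree_of_nat k, tree_of_nat k] (tree_of_nat (2 * k)) (20 * (m + 1))"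
    using computes_mono[OF computes_app[of T k k]] k by (simp add: mult_2)
  have leq: "computes (prog T) f_leq [tree_of_nats C, tree_of_nat (2 * k)]
      (tree_of_bool (length C \<le> 2 * k)) (20 * (m + 1))"
    unfolding tree_of_nat_def[of "2 * k"]
    using computes_mono[OF computes_leq_list[of T "map tree_of_nat C" "replicate (2 * k) Leaf"]] len_C by simp
  have cands: "computes (prog T) f_cands
      [tree_of_nats [0..<n], tree_of_nats C, tree_of_nats [0..<n], tree_of_graph n E]
      (tree_of_nats (candidates T n E C)) (Suc m * (near_cost m + 100))"
    using computes_mono[OF computes_cands[OF n(2,1) E \<Gamma> set_C len_C, where R = "[0..<n]" and T = T]
        mult_le_mono1[of _ "Suc m"]] n(2)
    unfolding candidates_def by (simp add: subset_eq)
  have set_K: "set (candidates T n E C) \<subseteq> {..<n}" unfolding candidates_def by auto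
  have search: "computes (prog T) f_search
      [tree_of_nat (2 * k), Leaf, tree_of_nats (candidates T n E C), tree_of_nats [0..<n],
       tree_of_graph n E, tree_of_graph n \<Gamma>]
      (tree_of_bool (search_result T n E \<Gamma> (candidates T n E C) (2 * k) []))
      (search_cost m (length (candidates T n E C)) (2 * k))"
    using computes_search[OF n(2,1) E \<Gamma> set_K, of "[]" "2 * k"] k by simp
  define p where "p \<longleftrightarrow> length C \<le> 2 * k"
  show ?thesis
    unfolding p_def[symmetric]
    by (rule prog_computesI, cases p)
      (auto simp: b_main_def wp_simps tree_of_bool_def main_cost_def simp del: mult_2
        intro!: wp_callI[OF verts] wp_callI[OF greedy] wp_callI[OF app] wp_callI[OF leq[folded p_def]]
          wp_callI[OF cands] wp_callI[OF search])
qed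

section \<open>Equivalence of the program's answer with the existence of a solution\<close>

lemma card_listed_edges: "finite (listed_edges S) \<and> 2 * card (listed_edges S) \<le> length S"
proof -
  have "finite (listed_pairs S) \<and> 2 * card (listed_pairs S) \<le> length S"
    by (induction S rule: listed_pairs.induct) (auto simp: card_insert_if)
  moreover have eq: "listed_edges S = (\<lambda>(a, b). {a, b}) ` listed_pairs S"
    unfolding listed_edges_def by auto
  ultimately show ?thesis
    using card_image_le[of "listed_pairs S" "\<lambda>(a, b). {a, b}"] by auto
qed

lemma listed_edges_Cons2: "listed_edges (a # b # S) = insert {a, b} (listed_edges S)"
  unfolding listed_edges_def by auto

lemma list_edges:
  assumes "finite S" "S \<subseteq> all_pairs n"
  shows "\<exists>xs. listed_edges xs = S \<and> length xs = 2 * card S \<and> set xs \<subseteq> \<Union>S"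
  using assms
proof (induction S rule: finite_induct)
  case (insert e S)
  then obtain xs where xs: "listed_edges xs = S" "length xs = 2 * card S" "set xs \<subseteq> \<Union>S" by auto
  obtain a b where e: "e = {a, b}" using insert.prems by (auto elim: all_pairsE)
  show ?case
    using xs insert.hyps e
    by (intro exI[of _ "a # b # xs"]) (auto simp: listed_edges_Cons2)
qed (auto intro: exI[of _ "[]"])

lemma augmentable_iff:
  assumes G: "simple_graph n G" and \<Gamma>: "simple_graph n \<Gamma>" and "1 \<le> t"
    and T: "T = nat \<lfloor>t\<rfloor>" and C: "C = centers T n G \<Gamma> [0..<n] []"
  shows "dilation_augmentable t (n, G, \<Gamma>, k) \<longleftrightarrow>
    length C \<le> 2 * k \<and> search_result T n G \<Gamma> (candidates T n G C) (2 * k) []"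
proof
  note dil = dilation_at_most_iff[OF \<Gamma> \<open>1 \<le> t\<close>, folded T]
  let ?K = "candidates T n G C"
  have ok_iff: "(\<forall>v<n. {u, v} \<in> \<Gamma> \<longrightarrow> aug_dist G \<Gamma> [] u v \<le> enat T) \<longleftrightarrow> (\<nexists>v. conflict T \<Gamma> G u v)" for u
    using edge_neq[OF \<Gamma>] by (auto simp: conflict_def)
  {
    assume "dilation_augmentable t (n, G, \<Gamma>, k)"
    then obtain S where S: "S \<subseteq> non_edges n G" "card S \<le> k" "dilation_at_most n \<Gamma> (G \<union> S) t"
      unfolding dilation_augmentable_def by auto
    have S_pairs: "S \<subseteq> all_pairs n" using S(1) by (auto simp: non_edges_def)
    then have S_Pow: "S \<subseteq> Pow {..<n}" by (intro simple_graph_Pow) (simp add: simple_graph_def)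
    have fin: "finite S" using S_pairs finite_all_pairs by (rule finite_subset)
    have sol: "weighted_dist (hop_dist \<Gamma>) (G \<union> S) u v \<le> enat T" if "{u, v} \<in> \<Gamma>" for u v
      using S(3) that edge_neq[OF \<Gamma> that] unfolding dil by blast
    have sorted: "sorted_wrt (\<lambda>x c. \<not> hop_dist G c x \<le> enat (2 * T)) C"
      unfolding C by (rule sorted_wrt_greedy_centers) simp
    \<comment> \<open>A repeated center would be at distance 0 from its own copy.\<close>
    have "hop_dist G x x \<le> enat (2 * T)" for x by simp
    then have "distinct C"
      using sorted by (induction C) auto
    have far: "\<not> hop_dist G c c' \<le> enat (2 * T)" if "c \<in> set C" "c' \<in> set C" "c \<noteq> c'" for c c'
      using that sorted by (induction C) (auto simp: hop_dist_commute)
    have conf: "\<exists>v. conflict T \<Gamma> G c v" if "c \<in> set C" for c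
    proof -
      have "\<not> (\<forall>v<n. {c, v} \<in> \<Gamma> \<longrightarrow> aug_dist G \<Gamma> [] c v \<le> enat T)"
        using subsetD[OF set_greedy_centers that[unfolded C]]
        by (simp only: list.set(1) Un_iff mem_Collect_eq empty_iff simp_thms)
      then show ?thesis unfolding ok_iff by blast
    qed
    have len: "length C \<le> 2 * k"
      using solution_card_centers[OF G \<Gamma> S_pairs sol, of "set C", OF _ conf far] distinct_card[OF \<open>distinct C\<close>] S(2) by simp
    \<comment> \<open>The radius of the candidates is the sum of two: 2T from a center to a vertex
      in conflict, and T^2 from there to the repairing walks.\<close>
    have "x \<in> set ?K" if x: "x < n" "conflict T \<Gamma> G y z" "hop_dist G y x \<le> enat (T * T)" for x y z
    proof -
      have "y \<in> set [0..<n]" using x(2) edge_neq[OF \<Gamma>] by (auto simp: conflict_def)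
      moreover have "\<not> (\<forall>v<n. {y, v} \<in> \<Gamma> \<longrightarrow> aug_dist G \<Gamma> [] y v \<le> enat T)"
        using x(2) unfolding ok_iff by blast
      ultimately have "\<exists>c\<in>set C. hop_dist G c y \<le> enat (2 * T)"
        unfolding C by (intro greedy_centers_cover) simp_all
      then obtain c where c: "c \<in> set C" "hop_dist G c y \<le> enat (2 * T)" by blast
      have "hop_dist G c x \<le> enat (2 * T) + enat (T * T)"
        using hop_dist_triangle[of G c x y] c(2) x(3) by (meson add_mono order_trans)
      then show ?thesis using c(1) x(1) by (auto simp: candidates_def add.commute)
    qed
    note restr = solution_restrict[OF G \<Gamma> sol this S_Pow]
    let ?S = "{e \<in> S. e \<subseteq> set ?K}"
    have "finite ?S" "?S \<subseteq> all_pairs n" using fin S_pairs by auto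
    from list_edges[OF this] obtain xs
      where xs: "listed_edges xs = ?S" "length xs = 2 * card ?S" "set xs \<subseteq> \<Union>?S"
      by (elim exE conjE)
    have "card ?S \<le> k" using card_mono[OF fin, of ?S] S(2) by auto
    moreover have "augments T n G \<Gamma> xs"
      unfolding augments_def xs(1) by (intro allI impI restr)
    moreover have "set xs \<subseteq> set ?K" using xs(3) by blast
    ultimately have "search_result T n G \<Gamma> ?K (2 * k) []"
      unfolding search_result_def using xs(2) by (intro exI[of _ xs]) simp
    with len show "length C \<le> 2 * k \<and> search_result T n G \<Gamma> ?K (2 * k) []" ..
  }
  {
    assume "length C \<le> 2 * k \<and> search_result T n G \<Gamma> ?K (2 * k) []"
    then obtain xs where xs: "length xs \<le> 2 * k" "set xs \<subseteq> set ?K" "augments T n G \<Gamma> xs"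
      unfolding search_result_def by auto
    \<comment> \<open>The list may contain loops and edges of \<open>G\<close>. Both can be
      discarded without changing distances.\<close>
    define S where "S = listed_edges xs \<inter> non_edges n G"
    have xs_n: "set xs \<subseteq> {..<n}" using xs(2) by (auto simp: candidates_def)
    have L: "listed_edges xs \<subseteq> Pow {..<n}" using listed_edges_Pow[OF xs_n] .
    have "card S \<le> card (listed_edges xs)"
      using card_listed_edges[of xs] by (auto simp: S_def intro: card_mono)
    then have card: "card S \<le> k" using card_listed_edges[of xs] xs(1) by linarith
    have sub: "S \<subseteq> non_edges n G" by (simp add: S_def)
    have wd: "weighted_dist (hop_dist \<Gamma>) (G \<union> S) u v = aug_dist G \<Gamma> xs u v" if "u < n" for u v
    proof (rule wd_no_loops[OF that])
      show "{x, y} \<in> G \<union> S \<longleftrightarrow> {x, y} \<in> G \<union> listed_edges xs" if "x \<noteq> y" for x y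
      proof -
        have "{x, y} \<in> all_pairs n" if "{x, y} \<in> listed_edges xs"
        proof -
          have "x < n" "y < n" using subsetD[OF L that] by auto
          then show ?thesis using \<open>x \<noteq> y\<close> unfolding all_pairs_def by blast
        qed
        then show ?thesis unfolding S_def non_edges_def by blast
      qed
    next
      show "G \<union> S \<subseteq> Pow {..<n}" "G \<union> listed_edges xs \<subseteq> Pow {..<n}"
        using L simple_graph_Pow[OF G] unfolding S_def by (blast, simp)
    qed
    have "dilation_at_most n \<Gamma> (G \<union> S) t"
      unfolding dil
    proof (intro allI impI)
      fix u v assume "u < n" "v < n" "{u, v} \<in> \<Gamma>"
      then have "aug_dist G \<Gamma> xs u v \<le> enat T"
        using xs(3)[unfolded augments_def, rule_format, of u v] by (simp only:)
      then show "weighted_dist (hop_dist \<Gamma>) (G \<union> S) u v \<le> enat T"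
        by (simp only: wd[OF \<open>u < n\<close>])
    qed
    with sub card show "dilation_augmentable t (n, G, \<Gamma>, k)"
      unfolding dilation_augmentable_def prod.case by (intro exI[of _ S] conjI)
  }
qed

lemma length_candidates:
  assumes "simple_graph n G" "set C \<subseteq> {..<n}"
  shows "length (candidates T n G C) \<le> length C * (2 * max 1 (max_degree n G) ^ (T * T + 2 * T + 1))"
proof -
  let ?r = "T * T + 2 * T" and ?B = "2 * max 1 (max_degree n G) ^ (T * T + 2 * T + 1)"
  have ball: "finite {v. hop_dist G c v \<le> enat ?r}" "card {v. hop_dist G c v \<le> enat ?r} \<le> ?B" if "c \<in> set C" for c
    using hop_ball_bound[OF assms(1) _ refl, of c ?r] that assms(2) by auto
  have "length (candidates T n G C) = card (set (candidates T n G C))"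
    unfolding candidates_def by (rule distinct_card[symmetric]) simp
  also have "\<dots> \<le> card (\<Union>c\<in>set C. {v. hop_dist G c v \<le> enat ?r})"
    using ball(1) by (intro card_mono) (auto simp: candidates_def)
  also have "\<dots> \<le> (\<Sum>c\<in>set C. card {v. hop_dist G c v \<le> enat ?r})"
    by (rule card_UN_le) simp
  also have "\<dots> \<le> (\<Sum>c\<in>set C. ?B)" using ball(2) by (rule sum_mono)
  also have "\<dots> \<le> length C * ?B" by (simp add: card_length mult_right_mono)
  finally show ?thesis .
qed

section \<open>The running time\<close>

text \<open>Only the existence of a polynomial bound matters, so closure under sums and products
  replaces any expansion of the nested costs. The restriction to positive \<open>m\<close> allows
  exponents to be raised to a common one.\<close>

definition poly_bounded :: "(nat \<Rightarrow> nat) \<Rightarrow> bool" where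
  "poly_bounded f \<longleftrightarrow> (\<exists>A p. \<forall>m\<ge>1. f m \<le> A * m ^ p)"

lemma poly_bounded_const: "poly_bounded (\<lambda>m. c)"
  unfolding poly_bounded_def by (intro exI[of _ c] exI[of _ 0]) simp

lemma poly_bounded_id: "poly_bounded (\<lambda>m. m)"
  unfolding poly_bounded_def by (intro exI[of _ 1]) simp

lemma poly_bounded_add:
  assumes "poly_bounded f" "poly_bounded g" shows "poly_bounded (\<lambda>m. f m + g m)"
proof -
  obtain A p B q where f: "\<And>m. m \<ge> 1 \<Longrightarrow> f m \<le> A * m ^ p" and g: "\<And>m. m \<ge> 1 \<Longrightarrow> g m \<le> B * m ^ q"
    using assms unfolding poly_bounded_def by blast
  have "f m + g m \<le> (A + B) * m ^ (p + q)" if "m \<ge> 1" for m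
  proof -
    have "A * m ^ p \<le> A * m ^ (p + q)" "B * m ^ q \<le> B * m ^ (p + q)"
      using that by (auto intro!: mult_le_mono2 power_increasing)
    then show ?thesis using f[OF that] g[OF that] unfolding distrib_right by linarith
  qed
  then show ?thesis unfolding poly_bounded_def by blast
qed

lemma poly_bounded_mult:
  assumes "poly_bounded f" "poly_bounded g" shows "poly_bounded (\<lambda>m. f m * g m)"
proof -
  obtain A p B q where f: "\<And>m. m \<ge> 1 \<Longrightarrow> f m \<le> A * m ^ p" and g: "\<And>m. m \<ge> 1 \<Longrightarrow> g m \<le> B * m ^ q"
    using assms unfolding poly_bounded_def by blast
  have "f m * g m \<le> (A * B) * m ^ (p + q)" if "m \<ge> 1" for m
    using mult_le_mono[OF f[OF that] g[OF that]] by (simp add: power_add ac_simps)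
  then show ?thesis unfolding poly_bounded_def by blast
qed

lemma poly_bounded_Suc: "poly_bounded f \<Longrightarrow> poly_bounded (\<lambda>m. Suc (f m))"
  using poly_bounded_add[OF _ poly_bounded_const[of 1]] by simp

text \<open>No cost mentions \<open>T\<close>, so the coefficient and the exponent obtained from
  this serve all \<open>t\<close> at once, as the order of the quantifiers in the theorem
  demands.\<close>

lemma poly_bounded_costs: "poly_bounded (\<lambda>m. main_cost m + (ok_cost m + 200))"
  unfolding main_cost_def ok_cost_def near_cost_def row_cost_def wd_cost_def wt_cost_def hop_cost_def
    hop_wt_cost_def dist_cost_def step_cost_def loop_cost_def edge_cost_def
  by (intro poly_bounded_add poly_bounded_mult poly_bounded_Suc poly_bounded_const poly_bounded_id)

text \<open>From k = 2 on, k is at most k log k and a factor H^k is absorbed in the exponent. For k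
  = 1 that exponent vanishes, and the leading factor \<open>H\<close> pays; for k = 0 the left side
  is 1.\<close>

lemma powers_le_two_powr:
  fixes H :: real
  assumes "1 \<le> H"
  shows "H ^ k * real k ^ (2 * k) \<le> H * 2 powr ((log 2 H + 2) * (real k * log 2 (real k)))"
proof -
  consider "k = 0" | "k = 1" | "2 \<le> k" by linarith
  then show ?thesis
  proof cases
    case 3
    define l where "l = real k * log 2 (real k)"
    have "1 \<le> log 2 (real k)" using 3 by (simp add: le_log_iff)
    then have kl: "real k \<le> l" using 3 unfolding l_def by (simp add: mult_le_cancel_left1)
    have lH: "0 \<le> log 2 H" using assms by simp
    have "H ^ k = 2 powr (log 2 H * real k)"
      using assms by (simp add: powr_powr[symmetric] powr_realpow)
    also have "\<dots> \<le> 2 powr (log 2 H * l)"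
      using kl lH by (simp add: mult_left_mono)
    finally have "H ^ k \<le> 2 powr (log 2 H * l)" .
    moreover have "real k ^ (2 * k) = 2 powr (2 * l)"
    proof -
      have "2 powr (2 * l) = (2 powr log 2 (real k)) powr real (2 * k)"
        unfolding powr_powr l_def by (simp add: ac_simps)
      also have "\<dots> = real k powr real (2 * k)" using 3 by simp
      also have "\<dots> = real k ^ (2 * k)" using 3 by (intro powr_realpow) simp
      finally show ?thesis by simp
    qed
    ultimately have "H ^ k * real k ^ (2 * k) \<le> 2 powr (log 2 H * l) * 2 powr (2 * l)"
      by (simp add: mult_right_mono)
    also have "\<dots> = 1 * 2 powr ((log 2 H + 2) * l)" by (simp add: powr_add[symmetric] distrib_right)
    also have "\<dots> \<le> H * 2 powr ((log 2 H + 2) * l)" using assms by (intro mult_right_mono) auto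
    finally show ?thesis unfolding l_def .
  qed (use assms in auto)
qed

text \<open>For k > 0, N + 1 is at most 5 * k * D^e, and squaring the 5 gives the base 25. The
  powers of 2k + 1, from the size bound and from the search, are bounded through 2k + 1 \<le>
  3^k.\<close>

lemma total_cost_bound:
  fixes A p k N D e n :: nat
  assumes "n \<ge> 1" "D \<ge> 1" and N: "N \<le> 2 * k * (2 * D ^ e)"
  shows "real (A * (n * (2 * k + 1)) ^ p * ((2 * k + 1) * (N + 1) ^ (2 * k)))
    \<le> real A * (real (25 * 3 ^ (p + 1)) ^ k * real k ^ (2 * k)) * real D ^ (2 * k * e) * real n ^ p"
proof -
  have three: "2 * k + 1 \<le> 3 ^ k" by (induction k) auto
  have "(N + 1) ^ (2 * k) \<le> 25 ^ k * k ^ (2 * k) * D ^ (2 * k * e)"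
  proof (cases "k = 0")
    case False
    have "1 \<le> k * D ^ e" using False assms(2) by simp
    moreover have "2 * k * (2 * D ^ e) = 4 * (k * D ^ e)" by simp
    ultimately have "N + 1 \<le> 5 * (k * D ^ e)" using N by linarith
    then have "(N + 1) ^ (2 * k) \<le> (5 * (k * D ^ e)) ^ (2 * k)" by (rule power_mono) simp
    also have "\<dots> = 5 ^ (2 * k) * k ^ (2 * k) * D ^ (2 * k * e)"
      by (simp add: power_mult_distrib power_mult[symmetric] mult.commute)
    also have "(5 :: nat) ^ (2 * k) = 25 ^ k" by (simp add: power_mult)
    finally show ?thesis .
  qed simp
  moreover have "(2 * k + 1) ^ p * (2 * k + 1) \<le> (3 ^ (p + 1)) ^ k"
  proof -
    have "(2 * k + 1) ^ (p + 1) \<le> (3 ^ k) ^ (p + 1)" using three by (rule power_mono) simp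
    then show ?thesis by (simp add: power_mult[symmetric] mult.commute)
  qed
  ultimately have "((2 * k + 1) ^ p * (2 * k + 1)) * (N + 1) ^ (2 * k) \<le>
      (3 ^ (p + 1)) ^ k * (25 ^ k * k ^ (2 * k) * D ^ (2 * k * e))"
    by (rule mult_le_mono[rotated])
  then have "(A * n ^ p) * (((2 * k + 1) ^ p * (2 * k + 1)) * (N + 1) ^ (2 * k)) \<le>
      (A * n ^ p) * ((3 ^ (p + 1)) ^ k * (25 ^ k * k ^ (2 * k) * D ^ (2 * k * e)))"
    by (rule mult_le_mono2)
  also have "\<dots> = A * ((25 * 3 ^ (p + 1)) ^ k * k ^ (2 * k)) * D ^ (2 * k * e) * n ^ p"
    by (simp only: power_mult_distrib ac_simps)
  finally have "A * (n * (2 * k + 1)) ^ p * ((2 * k + 1) * (N + 1) ^ (2 * k)) \<le>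
      A * ((25 * 3 ^ (p + 1)) ^ k * k ^ (2 * k)) * D ^ (2 * k * e) * n ^ p"
    by (simp only: power_mult_distrib ac_simps)
  then have "real (A * (n * (2 * k + 1)) ^ p * ((2 * k + 1) * (N + 1) ^ (2 * k))) \<le>
      real (A * ((25 * 3 ^ (p + 1)) ^ k * k ^ (2 * k)) * D ^ (2 * k * e) * n ^ p)"
    by (simp only: of_nat_le_iff)
  then show ?thesis by simp
qed

theorem theorem27:
  "\<exists>C a b c :: real. \<forall>t :: real. 1 \<le> t \<longrightarrow>
     (\<exists>P :: program.
        decides_within P encode_instance valid_instance (dilation_augmentable t)
          (\<lambda>(n, G, \<Gamma>, k).
             C * 2 powr (a * (real k * log 2 (real k)))
               * real (max 1 (max_degree n G)) powr (b * (real k * t\<^sup>2))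
               * real n powr c))"
proof -
  obtain A p where cost: "\<And>m. m \<ge> 1 \<Longrightarrow> main_cost m + (ok_cost m + 200) \<le> A * m ^ p"
    using poly_bounded_costs unfolding poly_bounded_def by blast
  define H where "H = real (25 * 3 ^ (p + 1))"
  have "0 < (25 * 3 ^ (p + 1) :: nat)" by simp
  then have H: "1 \<le> H" unfolding H_def by linarith
  have "decides_within (prog (nat \<lfloor>t\<rfloor>)) encode_instance valid_instance (dilation_augmentable t)
          (\<lambda>(n, G, \<Gamma>, k).
             (real A * H) * 2 powr ((log 2 H + 2) * (real k * log 2 (real k)))
               * real (max 1 (max_degree n G)) powr (8 * (real k * t\<^sup>2))
               * real n powr real p)" if t: "1 \<le> t" for t
    unfolding decides_within_def
  proof (intro allI impI)
    fix x assume "valid_instance x"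
    then obtain n G \<Gamma> k where x: "x = (n, G, \<Gamma>, k)" and n: "0 < n"
      and G: "simple_graph n G" and \<Gamma>: "simple_graph n \<Gamma>"
      unfolding valid_instance_def by (cases x) auto
    define T where "T = nat \<lfloor>t\<rfloor>"
    define C where "C = centers T n G \<Gamma> [0..<n] []"
    define N where "N = length (candidates T n G C)"
    define D where "D = max 1 (max_degree n G)"
    define e where "e = T * T + 2 * T + 1"
    \<comment> \<open>A product rather than a sum, so that powers of \<open>m\<close> split into a
      power of \<open>n\<close> and a factor depending on k alone.\<close>
    define m where "m = n * (2 * k + 1)"
    have "2 * k \<le> n * (2 * k)" and m_eq: "m = n * (2 * k) + n" using n by (simp_all add: m_def)
    then have m: "n \<le> m \<and> 2 * k \<le> m \<and> 1 \<le> m" using n by linarith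
    have "computes (prog T) f_main [tree_of_graph n G, tree_of_graph n \<Gamma>, tree_of_nat k]
      (tree_of_bool (dilation_augmentable t x))
      (main_cost m + (if length C \<le> 2 * k then search_cost m N (2 * k) else 0))"
      using computes_main[OF n _ _ simple_graph_Pow[OF G] simple_graph_Pow[OF \<Gamma>] C_def] m
      unfolding x augmentable_iff[OF G \<Gamma> t T_def C_def] N_def by blast
    then obtain U where U: "runs (prog T) (encode_instance x) (tree_of_bool (dilation_augmentable t x)) U"
      "U \<le> main_cost m + (if length C \<le> 2 * k then search_cost m N (2 * k) else 0)"
      unfolding computes_def wp_call_def wp_def runs_def x encode_instance_def f_main_def
      by (auto simp: length_greater_0_conv[symmetric] simp del: length_greater_0_conv)
    \<comment> \<open>If there are too many centers no search takes place, and 0 stands in for the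
      uncontrolled \<open>N\<close>.\<close>
    define N' where "N' = (if length C \<le> 2 * k then N else 0)"
    have N': "N' \<le> 2 * k * (2 * D ^ e)"
    proof (cases "length C \<le> 2 * k")
      case True
      have "set C \<subseteq> {..<n}"
        using set_greedy_centers[of _ _ "[0..<n]" "[]"] unfolding C_def by fastforce
      from length_candidates[OF G this, of T] True show ?thesis
        unfolding N'_def N_def D_def e_def by (auto intro: order_trans mult_le_mono1)
    qed (simp add: N'_def)
    have "U \<le> main_cost m + search_cost m N' (2 * k)"
      using U(2) unfolding N'_def by (auto split: if_splits)
    also have "\<dots> \<le> (main_cost m + (ok_cost m + 200)) * ((2 * k + 1) * (N' + 1) ^ (2 * k))"
    proof -
      have "1 * 1 \<le> (2 * k + 1) * (N' + 1) ^ (2 * k)" by (intro mult_le_mono one_le_power) simp_all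
      then have "1 \<le> (2 * k + 1) * (N' + 1) ^ (2 * k)" by (simp only: mult_1)
      then have "main_cost m * 1 \<le> main_cost m * ((2 * k + 1) * (N' + 1) ^ (2 * k))" by (rule mult_le_mono2)
      then show ?thesis
        unfolding search_cost_def distrib_right[of "main_cost m"] mult.assoc by linarith
    qed
    also have "\<dots> \<le> A * m ^ p * ((2 * k + 1) * (N' + 1) ^ (2 * k))"
      using cost[of m] m by (intro mult_le_mono1) blast
    finally have "real U \<le> real (A * (n * (2 * k + 1)) ^ p * ((2 * k + 1) * (N' + 1) ^ (2 * k)))"
      unfolding m_def by (simp only: of_nat_le_iff)
    also have "\<dots> \<le> real A * (H ^ k * real k ^ (2 * k)) * real D ^ (2 * k * e) * real n ^ p"
      unfolding H_def by (rule total_cost_bound) (use n N' in \<open>auto simp: D_def\<close>)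
    also have "\<dots> \<le> real A * (H * 2 powr ((log 2 H + 2) * (real k * log 2 (real k))))
        * real D powr (8 * (real k * t\<^sup>2)) * real n ^ p"
    proof (rule mult_right_mono[OF mult_mono[OF mult_left_mono[OF powers_le_two_powr[OF H]]]])
      \<comment> \<open>As t \<ge> 1, each of T^2, T and 1 is at most t^2, so e is at most 4 * t^2;
        the exponent 2ke then gives the constant 8.\<close>
      have "real T \<le> t" using t unfolding T_def by simp
      moreover from this have "real T * real T \<le> t * t" using t by (intro mult_mono) auto
      moreover have "1 * t \<le> t * t" using t by (intro mult_right_mono) auto
      ultimately have "real T * real T + 2 * real T + 1 \<le> 4 * (t * t)" using t by linarith
      then have "real e \<le> 4 * t\<^sup>2" unfolding e_def by (simp add: power2_eq_square)
      then have "real (2 * k * e) \<le> 8 * (real k * t\<^sup>2)"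
        using mult_left_mono[of "real e" "4 * t\<^sup>2" "2 * real k"] by simp
      moreover have "1 \<le> real D" unfolding D_def by simp
      ultimately show "real D ^ (2 * k * e) \<le> real D powr (8 * (real k * t\<^sup>2))"
        by (subst powr_realpow[symmetric]) (auto intro: powr_mono)
    qed (use H in auto)
    finally have "real U \<le> (case x of (n, G, \<Gamma>, k) \<Rightarrow>
        (real A * H) * 2 powr ((log 2 H + 2) * (real k * log 2 (real k)))
               * real (max 1 (max_degree n G)) powr (8 * (real k * t\<^sup>2)) * real n powr real p)"
      using n unfolding x D_def by (simp add: powr_realpow mult.assoc)
    then show "\<exists>out U. runs (prog (nat \<lfloor>t\<rfloor>)) (encode_instance x) out U \<and>
        (out \<noteq> Leaf \<longleftrightarrow> dilation_augmentable t x) \<and>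
        real U \<le> (case x of (n, G, \<Gamma>, k) \<Rightarrow>
        (real A * H) * 2 powr ((log 2 H + 2) * (real k * log 2 (real k)))
               * real (max 1 (max_degree n G)) powr (8 * (real k * t\<^sup>2)) * real n powr real p)"
      using U(1) unfolding T_def[symmetric] by (intro exI[of _ "tree_of_bool (dilation_augmentable t x)"] exI[of _ U]) simp
  qed
  then show ?thesis by blast
qed

end
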